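(* Let $\mathbb{F}$ be a field of characteristic not $2$ and let $\Phi: M_n(\mathbb{F}) \to M_r(\mathbb{F})$ be a linear map sending idempotents to idempotents. Then $\Phi$ is a Jordan homomorphism, and there exist an invertible $S \in M_r(\mathbb{F})$ and nonnegative integers $k_1,k_2$ with $t = r - nk_1 - nk_2 \ge 0$ such that $$\Phi(A) = S\begin{pmatrix} I_{k_1}\otimes A & & \\ & I_{k_2}\otimes A^{\mathrm t} & \\ & & 0_t\end{pmatrix}S^{-1}\quad\text{for all } A\in M_n(\mathbb{F}).$$
   Context: A linear map $\Phi$ is a Jordan homomorphism if $\Phi(AB+BA) = \Phi(A)\Phi(B)+\Phi(B)\Phi(A)$ for all $A,B$. $I_k\otimes A$ denotes $A\oplus\cdots\oplus A$ ($k$ copies); $A^{\mathrm t}$ is the transpose. Unspecified blocks are zero. *)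

theory Defs
  imports "Jordan_Normal_Form.Matrix"
begin

definition idempotent_mat :: "'a::semiring_1 mat \<Rightarrow> bool" where
  "idempotent_mat A \<longleftrightarrow> A * A = A"

definition kron_id :: "nat \<Rightarrow> 'a::zero mat \<Rightarrow> 'a mat" where
  "kron_id k A = mat (k * dim_row A) (k * dim_col A)
     (\<lambda>(i, j). if i div dim_row A = j div dim_col A
               then A $$ (i mod dim_row A, j mod dim_col A) else 0)"

definition block_diag3 :: "'a::zero mat \<Rightarrow> 'a mat \<Rightarrow> 'a mat \<Rightarrow> 'a mat" where
  "block_diag3 X Y Z =
     four_block_mat
       (four_block_mat X (0\<^sub>m (dim_row X) (dim_col Y)) (0\<^sub>m (dim_row Y) (dim_col X)) Y)
       (0\<^sub>m (dim_row X + dim_row Y) (dim_col Z))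
       (0\<^sub>m (dim_row Z) (dim_col X + dim_col Y)) Z"

end

theory Submission
  imports Defs "Jordan_Normal_Form.Determinant"
begin

text \<open>
  Testing \<open>\<Phi>\<close> on a few idempotents supported on two or three indices yields all the Jordan relations
  that are needed between the images \<open>E i j\<close> of the matrix units; for \<open>E i j\<close> and \<open>E j i\<close> the
  idempotent is \<open>2 E i i - E j j + E i j - 2 E j i\<close>, whose coefficients are integers, so that it
  is available over every field. The Peirce decomposition \<open>E i j = E i i * E i j + E j j * E i j\<close> then splits \<open>E\<close>
  into a system of matrix units and a transposed one that annihilate each other. A system of matrix
  units \<open>M i j\<close> is brought to the form \<open>I\<^sub>k \<otimes> A\<close> by a full rank factorization \<open>M 0 0 = D S\<close>, \<open>S D = I\<^sub>k\<close>:
  the columns \<open>M i 0 D\<close> and the rows \<open>S M 0 j\<close> are dual to each other. Factoring the complementary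
  idempotent in the same way completes these columns to an invertible matrix.
\<close>

section \<open>Jordan systems of matrix units\<close>

text \<open>Squaring \<open>p + q\<close> gives \<open>p * q + q * p = 0\<close>. Multiplying this
  by \<open>p\<close> on the left and on the right yields
  \<open>p * q = - (p * q * p) = q * p\<close>, so \<open>p * q\<close> doubled is 0.\<close>

lemma orthogonal_idempotents:
  fixes p q :: "'b::ring"
  assumes no2: "\<forall>x::'b. x + x = 0 \<longrightarrow> x = 0"
    and p: "p * p = p" and q: "q * q = q" and pq: "(p + q) * (p + q) = p + q"
  shows "p * q = 0" "q * p = 0"
proof -
  have s: "p * q + q * p = 0"
    using pq by (simp add: algebra_simps p q)
  have "p * (p * q + q * p) = 0" "(p * q + q * p) * p = 0"
    by (simp_all add: s)
  then have "p * q + p * q * p = 0" "p * q * p + q * p = 0"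
    using p by (simp_all add: distrib_left distrib_right flip: mult.assoc) (simp add: mult.assoc)
  then have "p * q = q * p"
    by (metis add.commute add_left_cancel)
  with s no2 show "p * q = 0" "q * p = 0"
    by metis+
qed

lemma other_index:
  fixes n :: nat
  assumes "2 \<le> n"
  shows "\<exists>l<n. l \<noteq> i"
  using assms by (intro exI[of _ "if i = 0 then 1 else 0"]) auto

text \<open>The relations hold for \<open>E i j = H i j + G j i\<close> whenever \<open>H\<close>
  and \<open>G\<close> are systems of matrix units that annihilate each other. For
  \<open>2 \<le> n\<close> the locale recovers such \<open>H\<close> and \<open>G\<close> from
  them.\<close>

locale jordan_matrix_units =
  fixes E :: "nat \<Rightarrow> nat \<Rightarrow> 'b::ring" and n :: nat
  assumes diag_idem: "i < n \<Longrightarrow> E i i * E i i = E i i"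
    and diag_orth: "i < n \<Longrightarrow> j < n \<Longrightarrow> i \<noteq> j \<Longrightarrow> E i i * E j j = 0"
    and diag_left_zero: "\<lbrakk>i < n; j < n; k < n; i \<noteq> j; k \<noteq> i; k \<noteq> j\<rbrakk> \<Longrightarrow> E k k * E i j = 0"
    and diag_right_zero: "\<lbrakk>i < n; j < n; k < n; i \<noteq> j; k \<noteq> i; k \<noteq> j\<rbrakk> \<Longrightarrow> E i j * E k k = 0"
    and row_jordan: "\<lbrakk>i < n; j < n; i \<noteq> j\<rbrakk> \<Longrightarrow> E i i * E i j + E i j * E i i = E i j"
    and col_jordan: "\<lbrakk>i < n; j < n; i \<noteq> j\<rbrakk> \<Longrightarrow> E j j * E i j + E i j * E j j = E i j"
    and square_zero: "\<lbrakk>i < n; j < n; i \<noteq> j\<rbrakk> \<Longrightarrow> E i j * E i j = 0"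
    and flip_jordan: "\<lbrakk>i < n; j < n; i \<noteq> j\<rbrakk> \<Longrightarrow> E i j * E j i + E j i * E i j = E i i + E j j"
    and chain_jordan: "\<lbrakk>i < n; j < n; k < n; i \<noteq> j; j \<noteq> k; i \<noteq> k\<rbrakk>
      \<Longrightarrow> E i j * E j k + E j k * E i j = E i k"
    and same_row_jordan: "\<lbrakk>i < n; j < n; k < n; i \<noteq> j; i \<noteq> k; j \<noteq> k\<rbrakk>
      \<Longrightarrow> E i j * E i k + E i k * E i j = 0"
    and same_col_jordan: "\<lbrakk>i < n; j < n; k < n; i \<noteq> k; j \<noteq> k; i \<noteq> j\<rbrakk>
      \<Longrightarrow> E i k * E j k + E j k * E i k = 0"
begin

text \<open>Every fact of the locale thus has a mirror image; the interpretations \<open>T\<close>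
  below use it for the transposed component.\<close>

lemma transposed: "jordan_matrix_units (\<lambda>i j. E j i) n"
proof (unfold_locales, goal_cases)
  case 1 then show ?case by (rule diag_idem)
next
  case 2 then show ?case by (rule diag_orth)
next
  case 3 then show ?case by (simp add: diag_left_zero)
next
  case 4 then show ?case by (simp add: diag_right_zero)
next
  case (5 i j) then show ?case by (simp add: col_jordan)
next
  case (6 i j) then show ?case by (simp add: row_jordan)
next
  case (7 i j) then show ?case by (simp add: square_zero)
next
  case (8 i j) then show ?case using flip_jordan[of j i] by (simp add: add.commute)
next
  case (9 i j k) then show ?case using chain_jordan[of k j i] by (simp add: add.commute)
next
  case (10 i j k) then show ?case using same_col_jordan[of j k i] by simp
next
  case (11 i j k) then show ?case using same_row_jordan[of k i j] by simp
qed

text \<open>If \<open>E i j = H i j + G j i\<close> with \<open>i \<noteq> j\<close>, left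
  multiplication by \<open>E i i\<close> keeps \<open>H i j\<close> and kills \<open>G j i\<close>:
  this is the homomorphic Peirce component.\<close>

definition offdiag :: "nat \<Rightarrow> nat \<Rightarrow> 'b" where
  "offdiag i j = E i i * E i j"

text \<open>Both sides equal \<open>E i i * E i j * E j j\<close>: multiply
  \<open>col_jordan\<close> by \<open>E i i\<close> on the left and \<open>row_jordan\<close> by
  \<open>E j j\<close> on the right.\<close>

lemma diag_move:
  assumes "i < n" "j < n" "i \<noteq> j"
  shows "E i i * E i j = E i j * E j j"
proof -
  have "E i i * (E j j * E i j + E i j * E j j) = E i i * E i j * E j j"
    using diag_orth[of i j] assms by (simp add: distrib_left flip: mult.assoc)
  moreover have "(E i i * E i j + E i j * E i i) * E j j = E i i * E i j * E j j"
    using diag_orth[of i j] assms by (simp add: distrib_right mult.assoc)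
  ultimately show ?thesis
    using assms by (simp add: row_jordan col_jordan)
qed

lemma offdiag_left:
  assumes "i < n" "j < n" "i \<noteq> j"
  shows "E i i * offdiag i j = offdiag i j"
  using diag_idem[of i] assms by (simp add: offdiag_def flip: mult.assoc)

lemma offdiag_right:
  assumes "i < n" "j < n" "i \<noteq> j"
  shows "offdiag i j * E j j = offdiag i j"
  using assms by (metis diag_idem diag_move mult.assoc offdiag_def)

lemma offdiag_mult:
  assumes "i < n" "j < n" "i \<noteq> j"
  shows "offdiag i j * (E j j * y) = E i i * (E i j * y)"
  using offdiag_right[OF assms] by (metis mult.assoc offdiag_def)

text \<open>Multiplying \<open>chain_jordan\<close> by \<open>E i i\<close> on the left kills the
  reversed product, because \<open>E i i * E j k = 0\<close>.\<close>

lemma offdiag_chain: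
  assumes "i < n" "j < n" "k < n" "i \<noteq> j" "j \<noteq> k" "i \<noteq> k"
  shows "offdiag i j * offdiag j k = offdiag i k"
proof -
  have "E i i * (E i j * E j k + E j k * E i j) = E i i * (E i j * E j k)"
    using diag_left_zero[of j k i] assms by (simp add: distrib_left flip: mult.assoc)
  then show ?thesis
    using assms chain_jordan[of i j k] offdiag_mult[of i j "E j k"]
    by (simp add: offdiag_def[of j k] offdiag_def[of i k])
qed

text \<open>\<open>E j j * E k j\<close> is a component of the transposed system, so this is the
  source of the mutual annihilation. It comes from \<open>square_zero\<close> if
  \<open>i = k\<close>, and otherwise from \<open>same_col_jordan\<close> multiplied by
  \<open>E i i\<close>.\<close>

lemma offdiag_mixed:
  assumes "i < n" "j < n" "k < n" "i \<noteq> j" "j \<noteq> k"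
  shows "offdiag i j * (E j j * E k j) = 0"
proof (cases "i = k")
  case True
  then show ?thesis
    using assms square_zero[of i j] by (simp add: offdiag_mult)
next
  case False
  then have "E i i * (E i j * E k j + E k j * E i j) = E i i * (E i j * E k j)"
    using diag_left_zero[of k j i] assms by (simp add: distrib_left flip: mult.assoc)
  then show ?thesis
    using assms False same_col_jordan[of i k j] by (simp add: offdiag_mult)
qed

text \<open>\<open>flip_jordan\<close> multiplied by \<open>E j j\<close> splits
  \<open>E j j\<close> into a loop of homomorphic components and a loop of transposed ones.
  Multiplication by \<open>offdiag i j\<close> kills the second loop by
  \<open>offdiag_mixed\<close>.\<close>

lemma offdiag_roundtrip:
  assumes "i < n" "j < n" "i \<noteq> j"
  shows "offdiag i j * offdiag j i * offdiag i j = offdiag i j"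
proof -
  have "E j j * (E j i * E i j + E i j * E j i) = E j j"
    using flip_jordan[of j i] diag_idem[of j] diag_orth[of j i] assms by (simp add: distrib_left)
  moreover have "E j j * (E j i * E i j) = offdiag j i * offdiag i j"
    using assms by (simp add: offdiag_def[of i j] offdiag_mult)
  moreover have "E j j * (E i j * E j i) = E j j * E i j * (E i i * E j i)"
  proof -
    interpret T: jordan_matrix_units "\<lambda>i j. E j i" n by (rule transposed)
    show ?thesis using T.offdiag_mult[of j i "E j i"] assms by (simp add: T.offdiag_def)
  qed
  ultimately have "offdiag j i * offdiag i j + E j j * E i j * (E i i * E j i) = E j j"
    by (simp add: distrib_left)
  then have "offdiag i j * (offdiag j i * offdiag i j + E j j * E i j * (E i i * E j i)) = offdiag i j"
    using offdiag_right assms by simp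
  moreover have "offdiag i j * (E j j * E i j * (E i i * E j i)) = 0"
    using offdiag_mixed[of i j i] assms by (simp flip: mult.assoc)
  ultimately show ?thesis
    by (simp add: distrib_left mult.assoc)
qed

lemma offdiag_loop_indep:
  assumes "i < n" "j < n" "k < n" "i \<noteq> j" "i \<noteq> k"
  shows "offdiag i j * offdiag j i = offdiag i k * offdiag k i"
proof (cases "j = k")
  case False
  then have "offdiag i j * offdiag j i = offdiag i j * (offdiag j k * offdiag k i)"
    using assms by (simp add: offdiag_chain)
  also have "\<dots> = offdiag i j * offdiag j k * offdiag k i"
    by (simp add: mult.assoc)
  also have "\<dots> = offdiag i k * offdiag k i"
    using assms False by (simp add: offdiag_chain)
  finally show ?thesis .
qed simp

text \<open>
  On the diagonal the choice of the intermediate index \<open>l\<close> is immaterial once \<open>2 \<le> n\<close>.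
\<close>

definition hom_unit :: "nat \<Rightarrow> nat \<Rightarrow> 'b" where
  "hom_unit i j = (if i \<noteq> j then offdiag i j
     else let l = (if i = 0 then 1 else 0) in offdiag i l * offdiag l i)"

lemma hom_unit_diag:
  assumes "i < n" "j < n" "i \<noteq> j"
  shows "hom_unit i i = offdiag i j * offdiag j i"
  unfolding hom_unit_def Let_def
  using assms by (auto intro!: offdiag_loop_indep)

lemma hom_unit_ends:
  assumes "2 \<le> n" "i < n" "j < n"
  shows "E i i * hom_unit i j = hom_unit i j" "hom_unit i j * E j j = hom_unit i j"
proof -
  obtain l where "l < n" "l \<noteq> i" using other_index assms(1) by blast
  with assms have l: "hom_unit i i = offdiag i l * offdiag l i"
    "E i i * offdiag i l = offdiag i l" "offdiag l i * E i i = offdiag l i"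
    by (simp_all add: hom_unit_diag offdiag_left offdiag_right)
  show "E i i * hom_unit i j = hom_unit i j"
  proof (cases "i = j")
    case True
    with l show ?thesis by (simp flip: mult.assoc)
  qed (use assms in \<open>simp add: hom_unit_def offdiag_left\<close>)
  show "hom_unit i j * E j j = hom_unit i j"
  proof (cases "i = j")
    case True
    with l show ?thesis by (simp add: mult.assoc)
  qed (use assms in \<open>simp add: hom_unit_def offdiag_right\<close>)
qed

lemma hom_unit_mult:
  assumes "2 \<le> n" "i < n" "j < n" "k < n" "l < n"
  shows "hom_unit i j * hom_unit k l = (if j = k then hom_unit i l else 0)"
proof (cases "j = k")
  case False
  \<comment> \<open>The two factors absorb \<open>E j j\<close> and \<open>E k k\<close>, which are
    orthogonal.\<close>
  have "hom_unit i j * hom_unit k l = hom_unit i j * (E j j * E k k) * hom_unit k l"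
    using assms hom_unit_ends by (metis mult.assoc)
  with False assms show ?thesis
    by (simp add: diag_orth)
next
  case True
  obtain m where m: "m < n" "m \<noteq> j" using other_index assms(1) by blast
  \<comment> \<open>A diagonal factor is a loop through any other index. Next to an off-diagonal
    factor, that factor's second index is chosen, so that \<open>offdiag_roundtrip\<close> contracts
    the product.\<close>
  consider "i = j" "j = l" | "i = j" "j \<noteq> l" | "i \<noteq> j" "j = l" | "i \<noteq> j" "j \<noteq> l" by blast
  then have "hom_unit i j * hom_unit j l = hom_unit i l"
  proof cases
    case 1
    then show ?thesis using m assms offdiag_roundtrip[of l m]
      by (simp add: hom_unit_diag[of l m] flip: mult.assoc)
  next
    case 2
    then show ?thesis using assms offdiag_roundtrip[of j l]
      by (simp add: hom_unit_diag[of j l]) (simp add: hom_unit_def)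
  next
    case 3
    then show ?thesis using assms offdiag_roundtrip[of i j]
      by (simp add: hom_unit_diag[of l i]) (simp add: hom_unit_def[of i l] mult.assoc)
  next
    case 4
    then show ?thesis using assms
      by (cases "i = l") (simp_all add: hom_unit_diag[of l j] hom_unit_def[of _ j] hom_unit_def[of j]
          hom_unit_def[of i l] offdiag_chain)
  qed
  with True show ?thesis by simp
qed

text \<open>Exposes the off-diagonal factor to which \<open>offdiag_mixed\<close> applies. The ring
  need not have a 1, so off the diagonal the cofactor \<open>y\<close> is supplied by
  \<open>offdiag_roundtrip\<close>.\<close>

lemma hom_unit_right_factor:
  assumes "2 \<le> n" "i < n" "j < n"
  obtains y p where "p < n" "p \<noteq> j" "hom_unit i j = y * offdiag p j"
proof (cases "i = j")
  case True
  obtain l where "l < n" "l \<noteq> i" using other_index assms(1) by blast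
  with True that[of l "offdiag j l"] assms show ?thesis by (simp add: hom_unit_diag)
next
  case False
  with that[of i "offdiag i j * offdiag j i"] assms show ?thesis
    by (simp add: offdiag_roundtrip hom_unit_def)
qed

lemma hom_unit_left_factor:
  assumes "2 \<le> n" "i < n" "j < n"
  obtains y p where "p < n" "p \<noteq> i" "hom_unit i j = offdiag i p * y"
proof (cases "i = j")
  case True
  obtain l where "l < n" "l \<noteq> i" using other_index assms(1) by blast
  with True that[of l "offdiag l j"] assms show ?thesis by (simp add: hom_unit_diag)
next
  case False
  with that[of j "offdiag j i * offdiag i j"] assms show ?thesis
    by (simp add: offdiag_roundtrip hom_unit_def flip: mult.assoc)
qed

text \<open>For \<open>j \<noteq> k\<close> orthogonal diagonal elements stand between the factors.
  For \<open>j = k\<close> off-diagonal factors are split off on both sides of the point of contact,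
  and \<open>offdiag_mixed\<close> kills their product.\<close>

lemma hom_unit_mixed:
  assumes "2 \<le> n" "i < n" "j < n" "k < n" "l < n"
  shows "hom_unit i j * jordan_matrix_units.hom_unit (\<lambda>i j. E j i) k l = 0"
proof -
  interpret T: jordan_matrix_units "\<lambda>i j. E j i" n by (rule transposed)
  show ?thesis
  proof (cases "j = k")
    case False
    have "hom_unit i j * T.hom_unit k l = hom_unit i j * (E j j * E k k) * T.hom_unit k l"
      using assms hom_unit_ends T.hom_unit_ends by (metis mult.assoc)
    with False assms show ?thesis
      by (simp add: diag_orth)
  next
    case True
    obtain x p where p: "p < n" "p \<noteq> j" "hom_unit i j = x * offdiag p j"
      using assms by (elim hom_unit_right_factor)
    obtain y q where q: "q < n" "q \<noteq> j" "T.hom_unit j l = T.offdiag j q * y"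
      using assms by (elim T.hom_unit_left_factor)
    have "hom_unit i j * T.hom_unit j l = x * (offdiag p j * (E j j * E q j)) * y"
      by (simp add: p q mult.assoc T.offdiag_def)
    with p q assms True show ?thesis
      by (simp add: offdiag_mixed)
  qed
qed

text \<open>Off the diagonal this is \<open>row_jordan\<close> with one summand rewritten by
  \<open>T.diag_move\<close>. On the diagonal the two loops through \<open>l\<close> add up to
  \<open>E i i * (E i i + E l l) = E i i\<close> by \<open>flip_jordan\<close>.\<close>

lemma hom_unit_decomposition:
  assumes "2 \<le> n" "i < n" "j < n"
  shows "hom_unit i j + jordan_matrix_units.hom_unit (\<lambda>i j. E j i) j i = E i j"
proof -
  interpret T: jordan_matrix_units "\<lambda>i j. E j i" n by (rule transposed)
  show ?thesis
  proof (cases "i = j")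
    case False
    with assms T.diag_move[of j i] row_jordan[of i j] show ?thesis
      by (simp add: hom_unit_def T.hom_unit_def offdiag_def T.offdiag_def)
  next
    case True
    obtain l where l: "l < n" "l \<noteq> i" using other_index assms(1) by blast
    have "offdiag i l * offdiag l i + T.offdiag i l * T.offdiag l i
        = E i i * (E i l * E l i + E l i * E i l)"
      using offdiag_mult[of i l "E l i"] T.offdiag_mult[of i l "E i l"] l assms
      by (simp add: offdiag_def[of l i] T.offdiag_def[of l i] distrib_left)
    with l assms True show ?thesis
      by (simp add: hom_unit_diag[of j l] T.hom_unit_diag[of j l] flip_jordan distrib_left
          diag_idem diag_orth)
  qed
qed

end

section \<open>From idempotents to Jordan relations\<close>

definition idem_elem :: "'b::times \<Rightarrow> bool" where
  "idem_elem x \<longleftrightarrow> x * x = x"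

text \<open>Adding the two idempotence equations for \<open>p + x\<close> and \<open>p - x\<close>
  leaves \<open>x * x + x * x = 0\<close>; the first one then gives the Jordan product.\<close>

lemma idem_jordan_product:
  fixes p x :: "'b::ring"
  assumes no2: "\<forall>x::'b. x + x = 0 \<longrightarrow> x = 0"
    and p: "idem_elem p" and plus: "idem_elem (p + x)" and minus: "idem_elem (p - x)"
  shows "x * x = 0" "p * x + x * p = x"
proof -
  have pp: "p * p = p"
    using p by (simp add: idem_elem_def)
  have "p + (p * x + x * p + x * x) = (p + x) * (p + x)"
    by (simp add: algebra_simps pp)
  also have "\<dots> = p + x"
    using plus by (simp only: idem_elem_def)
  finally have 1: "p * x + x * p + x * x = x"
    by (rule add_left_imp_eq)
  have "p - (p * x + x * p) + x * x = (p - x) * (p - x)"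
    by (simp add: algebra_simps pp)
  also have "\<dots> = p - x"
    using minus by (simp only: idem_elem_def)
  finally have 2: "p - (p * x + x * p) + x * x = p - x" .
  have "x * x + x * x = (p - (p * x + x * p) + x * x) - p + (p * x + x * p + x * x)"
    by simp
  also have "\<dots> = 0"
    unfolding 1 2 by simp
  finally have "x * x + x * x = 0" .
  then show sq: "x * x = 0" using no2 by blast
  show "p * x + x * p = x" using 1 unfolding sq by simp
qed

lemma idem_jordan_square:
  fixes p u v :: "'b::ring"
  assumes "p * p = p" "u * u = 0" "v * v = 0" "idem_elem (p + u + v)"
    "p * u + u * p = u" "p * v + v * p = v"
  shows "u * v + v * u = 0"
proof -
  have "(p + u + v) + (u * v + v * u)
      = p * p + (p * u + u * p) + (p * v + v * p) + (u * u + v * v) + (u * v + v * u)"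
    unfolding assms by simp
  also have "\<dots> = (p + u + v) * (p + u + v)"
    by (simp add: algebra_simps)
  also have "\<dots> = p + u + v"
    using assms(4) by (simp only: idem_elem_def)
  finally show ?thesis
    by simp
qed

text \<open>Each combination is idempotent for genuine matrix units, hence also for their images
  under the map. In \<open>cross\<close> it is the rank one matrix with column
  \<open>e_i + e_j\<close> and row \<open>e_j + e_k\<close>. Multiples are written as sums because
  the ring has no numerals.\<close>

lemma jordan_matrix_units_of_idempotents:
  fixes E :: "nat \<Rightarrow> nat \<Rightarrow> 'b::ring"
  assumes no2: "\<forall>x::'b. x + x = 0 \<longrightarrow> x = 0"
    and diag: "\<And>i. i < n \<Longrightarrow> idem_elem (E i i)"
    and diag2: "\<And>i j. \<lbrakk>i < n; j < n; i \<noteq> j\<rbrakk> \<Longrightarrow> idem_elem (E i i + E j j)"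
    and row_plus: "\<And>i j. \<lbrakk>i < n; j < n; i \<noteq> j\<rbrakk> \<Longrightarrow> idem_elem (E i i + E i j)"
    and row_minus: "\<And>i j. \<lbrakk>i < n; j < n; i \<noteq> j\<rbrakk> \<Longrightarrow> idem_elem (E i i - E i j)"
    and col_plus: "\<And>i j. \<lbrakk>i < n; j < n; i \<noteq> j\<rbrakk> \<Longrightarrow> idem_elem (E j j + E i j)"
    and col_minus: "\<And>i j. \<lbrakk>i < n; j < n; i \<noteq> j\<rbrakk> \<Longrightarrow> idem_elem (E j j - E i j)"
    and disjoint: "\<And>i j k. \<lbrakk>i < n; j < n; k < n; i \<noteq> j; k \<noteq> i; k \<noteq> j\<rbrakk>
      \<Longrightarrow> idem_elem (E k k + (E i i + E i j))"
    and flip: "\<And>i j. \<lbrakk>i < n; j < n; i \<noteq> j\<rbrakk>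
      \<Longrightarrow> idem_elem (E i i + E i i - E j j + (E i j - (E j i + E j i)))"
    and cross: "\<And>i j k. \<lbrakk>i < n; j < n; k < n; i \<noteq> j; j \<noteq> k; i \<noteq> k\<rbrakk>
      \<Longrightarrow> idem_elem (E j j + E i j + E j k + E i k)"
    and row2: "\<And>i j k. \<lbrakk>i < n; j < n; k < n; i \<noteq> j; j \<noteq> k; i \<noteq> k\<rbrakk>
      \<Longrightarrow> idem_elem (E i i + E i j + E i k)"
    and col2: "\<And>i j k. \<lbrakk>i < n; j < n; k < n; i \<noteq> j; j \<noteq> k; i \<noteq> k\<rbrakk>
      \<Longrightarrow> idem_elem (E k k + E i k + E j k)"
  shows "jordan_matrix_units E n"
proof -
  have e: "E i i * E i i = E i i" if "i < n" for i
    using diag that by (simp add: idem_elem_def)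
  have orth: "E i i * E j j = 0" if "i < n" "j < n" "i \<noteq> j" for i j
    by (rule orthogonal_idempotents(1)[OF no2 e e diag2[unfolded idem_elem_def]]) (use that in auto)
  have row: "E i j * E i j = 0" "E i i * E i j + E i j * E i i = E i j"
    if "i < n" "j < n" "i \<noteq> j" for i j
    using idem_jordan_product[OF no2 diag row_plus row_minus, of i j] that by simp_all
  have col: "E j j * E i j + E i j * E j j = E i j"
    if "i < n" "j < n" "i \<noteq> j" for i j
    using idem_jordan_product(2)[OF no2 diag col_plus col_minus, of j i] that by simp
  have zero: "E k k * E i j = 0" "E i j * E k k = 0"
    if "i < n" "j < n" "k < n" "i \<noteq> j" "k \<noteq> i" "k \<noteq> j" for i j k
  proof -
    \<comment> \<open>Since \<open>E k k\<close> is also orthogonal to \<open>E i i\<close>, the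
      summand \<open>E i j\<close> is annihilated on its own.\<close>
    have "E k k * (E i i + E i j) = 0" "(E i i + E i j) * E k k = 0"
      using orthogonal_idempotents[OF no2 e[OF that(3)] row_plus[OF that(1,2,4), unfolded idem_elem_def]
        disjoint[OF that, unfolded idem_elem_def]] .
    then show "E k k * E i j = 0" "E i j * E k k = 0"
      using orth[of k i] orth[of i k] that by (simp_all add: distrib_left distrib_right)
  qed
  have flip_jordan: "E i j * E j i + E j i * E i j = E i i + E j j"
    if ij: "i < n" "j < n" "i \<noteq> j" for i j
  proof -
    define a b x y where abxy: "a = E i i" "b = E j j" "x = E i j" "y = E j i"
    have rules: "a * a = a" "b * b = b" "a * b = 0" "b * a = 0" "x * x = 0" "y * y = 0"
      unfolding abxy using ij e orth row(1) by simp_all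
    have jordan: "a * x + x * a = x" "b * x + x * b = x" "a * y + y * a = y" "b * y + y * b = y"
      unfolding abxy using ij row(2) col by simp_all
    \<comment> \<open>The idempotent of \<open>flip\<close> is split into its diagonal part
      \<open>z\<close> and its off-diagonal part \<open>w\<close>. As
      \<open>z * w + w * z = w\<close>, idempotence reduces to \<open>z * z + w * w = z\<close>,
      which is twice the claim.\<close>
    define z w where zw: "z = a + a - b" "w = x - (y + y)"
    have zz: "z * z = a + a + a + a + b"
      by (simp add: zw algebra_simps rules)
    have "z * w + w * z = (a * x + x * a) + (a * x + x * a) - (b * x + x * b)
      - ((a * y + y * a) + (a * y + y * a) + (a * y + y * a) + (a * y + y * a))
      + ((b * y + y * b) + (b * y + y * b))"
      by (simp add: zw algebra_simps)
    also have "\<dots> = w"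
      unfolding jordan by (simp add: zw)
    finally have zw': "z * w + w * z = w" .
    define s where "s = x * y + y * x"
    have ww: "w * w = - (s + s)"
      by (simp add: zw s_def algebra_simps rules)
    have "(z + w) * (z + w) = z + w"
      using flip[OF ij] by (simp only: idem_elem_def abxy zw)
    moreover have "(z + w) * (z + w) = z * z + (z * w + w * z) + w * w"
      by (simp add: algebra_simps)
    ultimately have "z * z + w + w * w = z + w"
      by (simp only: zw')
    then have "z * z + w * w + w = z + w"
      by (simp only: ac_simps)
    then have "z * z + w * w = z"
      by (rule add_right_imp_eq)
    moreover have "(s - (a + b)) + (s - (a + b)) = z - (z * z + w * w)"
      unfolding zz ww by (simp add: zw)
    ultimately have "(s - (a + b)) + (s - (a + b)) = 0"
      by (simp only: diff_self)
    then have "s - (a + b) = 0" using no2 by blast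
    then show ?thesis by (simp add: abxy s_def)
  qed
  have same_row: "E i j * E i k + E i k * E i j = 0"
    if "i < n" "j < n" "k < n" "i \<noteq> j" "i \<noteq> k" "j \<noteq> k" for i j k
    using idem_jordan_square[OF e row(1) row(1) row2 row(2) row(2), of i j k] that by simp
  have same_col: "E i k * E j k + E j k * E i k = 0"
    if "i < n" "j < n" "k < n" "i \<noteq> k" "j \<noteq> k" "i \<noteq> j" for i j k
    using idem_jordan_square[OF e row(1) row(1) col2 col col, of k i j] that by simp
  have chain: "E i j * E j k + E j k * E i j = E i k"
    if ijk: "i < n" "j < n" "k < n" "i \<noteq> j" "j \<noteq> k" "i \<noteq> k" for i j k
  proof -
    define p x y z where pxyz: "p = E j j" "x = E i j" "y = E j k" "z = E i k"
    have rules: "p * p = p" "x * x = 0" "y * y = 0" "z * z = 0" "p * z = 0" "z * p = 0"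
       "p * x + x * p = x" "p * y + y * p = y" "x * z + z * x = 0" "y * z + z * y = 0"
      unfolding pxyz using ijk e row col zero same_row[of i j k] same_col[of j i k] by simp_all
    \<comment> \<open>By the relations already proved, the square is \<open>p + x + y\<close> plus
      \<open>x * y + y * x\<close>; idempotence identifies the last sum with
      \<open>z\<close>.\<close>
    have "(p + x + y + z) * (p + x + y + z)
        = p * p + (x * x + y * y + z * z) + (p * z + z * p) + (p * x + x * p) + (p * y + y * p)
          + (x * z + z * x) + (y * z + z * y) + (x * y + y * x)"
      by (simp add: algebra_simps)
    also have "\<dots> = p + x + y + (x * y + y * x)"
      unfolding rules by simp
    finally have "p + x + y + (x * y + y * x) = p + x + y + z"
      using cross[OF ijk] by (simp only: idem_elem_def pxyz)
    then show ?thesis unfolding pxyz by (rule add_left_imp_eq)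
  qed
  show ?thesis
    by unfold_locales (rule e orth row col zero flip_jordan same_row same_col chain; assumption)+
qed

section \<open>Matrices as elements of a ring type\<close>

text \<open>The set \<open>S\<close> keeps track of where the new units live: they are products of
  the \<open>E i j\<close>, so closure under multiplication suffices to pull them back to matrices
  later.\<close>

lemma matrix_units_split:
  fixes E :: "nat \<Rightarrow> nat \<Rightarrow> 'b::ring"
  assumes "jordan_matrix_units E n"
    and S0: "0 \<in> S" and S_mult: "\<And>x y. x \<in> S \<Longrightarrow> y \<in> S \<Longrightarrow> x * y \<in> S"
    and S_E: "\<And>i j. i < n \<Longrightarrow> j < n \<Longrightarrow> E i j \<in> S"
  obtains H G :: "nat \<Rightarrow> nat \<Rightarrow> 'b"
  where "\<And>i j. i < n \<Longrightarrow> j < n \<Longrightarrow> H i j \<in> S"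
    and "\<And>i j. i < n \<Longrightarrow> j < n \<Longrightarrow> G i j \<in> S"
    and "\<And>i j k l. \<lbrakk>i < n; j < n; k < n; l < n\<rbrakk> \<Longrightarrow> H i j * H k l = (if j = k then H i l else 0)"
    and "\<And>i j k l. \<lbrakk>i < n; j < n; k < n; l < n\<rbrakk> \<Longrightarrow> G i j * G k l = (if j = k then G i l else 0)"
    and "\<And>i j k l. \<lbrakk>i < n; j < n; k < n; l < n\<rbrakk> \<Longrightarrow> H i j * G k l = 0"
    and "\<And>i j k l. \<lbrakk>i < n; j < n; k < n; l < n\<rbrakk> \<Longrightarrow> G i j * H k l = 0"
    and "\<And>i j. i < n \<Longrightarrow> j < n \<Longrightarrow> H i j + G j i = E i j"
proof (cases "2 \<le> n")
  \<comment> \<open>For \<open>n \<le> 1\<close> there is no second index to form loops with;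
    transposition is trivial there, so \<open>E\<close> itself serves as the homomorphic
    part.\<close>
  case False
  interpret jordan_matrix_units E n by fact
  from False consider "n = 0" | "n = 1" by linarith
  then show ?thesis
  proof cases
    case 1
    then show ?thesis by (intro that[of E "\<lambda>_ _. 0"]) auto
  next
    case 2
    then show ?thesis
      using S0 S_E[of 0 0] diag_idem[of 0] by (intro that[of E "\<lambda>_ _. 0"]) auto
  qed
next
  case True
  interpret jordan_matrix_units E n by fact
  interpret T: jordan_matrix_units "\<lambda>i j. E j i" n by (rule transposed)
  have mem: "hom_unit i j \<in> S" "T.hom_unit i j \<in> S" if "i < n" "j < n" for i j
    unfolding hom_unit_def offdiag_def T.hom_unit_def T.offdiag_def Let_def
    using that True by (auto intro!: S_mult S_E)
  show ?thesis
    by (rule that[of hom_unit T.hom_unit])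
      (use True in \<open>simp_all add: mem hom_unit_mult T.hom_unit_mult hom_unit_mixed T.hom_unit_mixed
        hom_unit_decomposition\<close>)
qed

text \<open>
  The additive endomorphisms of \<open>nat \<Rightarrow> 'a\<close> form a ring type into which all matrix rings embed, so
  that the ring identities above apply to matrices.
\<close>

typedef (overloaded) 'a endo =
  "{f :: (nat \<Rightarrow> 'a::ab_group_add) \<Rightarrow> nat \<Rightarrow> 'a.
     \<forall>u v. f (\<lambda>i. u i + v i) = (\<lambda>i. f u i + f v i)}"
  by (rule exI[of _ "\<lambda>v. v"]) simp

setup_lifting type_definition_endo

instantiation endo :: (ab_group_add) ring
begin

lift_definition zero_endo :: "'a endo" is "\<lambda>v i. 0" by simp
lift_definition plus_endo :: "'a endo \<Rightarrow> 'a endo \<Rightarrow> 'a endo" is "\<lambda>f g v i. f v i + g v i"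
  by (simp add: ac_simps)
lift_definition uminus_endo :: "'a endo \<Rightarrow> 'a endo" is "\<lambda>f v i. - f v i"
  by simp
lift_definition minus_endo :: "'a endo \<Rightarrow> 'a endo \<Rightarrow> 'a endo" is "\<lambda>f g v i. f v i - g v i"
  by (simp add: algebra_simps)
lift_definition times_endo :: "'a endo \<Rightarrow> 'a endo \<Rightarrow> 'a endo" is "\<lambda>f g v. f (g v)"
  by simp

instance
  by standard (transfer; simp add: ac_simps)+

end

text \<open>Matrices of all sizes act on one space of sequences: coordinates beyond the columns are
  ignored, those beyond the rows become 0. The identity matrix acts as a projection, which agrees
  with working in rings without 1.\<close>

lift_definition mat_act :: "'a::comm_ring_1 mat \<Rightarrow> 'a endo" is
  "\<lambda>A v i. if i < dim_row A then \<Sum>j<dim_col A. A $$ (i, j) * v j else 0"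
  by (auto simp: fun_eq_iff distrib_left sum.distrib)

lemma mat_act_add:
  "A \<in> carrier_mat m n \<Longrightarrow> B \<in> carrier_mat m n \<Longrightarrow> mat_act (A + B) = mat_act A + mat_act B"
  by transfer (auto simp: fun_eq_iff distrib_right sum.distrib)

lemma mat_act_diff:
  "A \<in> carrier_mat m n \<Longrightarrow> B \<in> carrier_mat m n \<Longrightarrow> mat_act (A - B) = mat_act A - mat_act B"
  by transfer (auto simp: fun_eq_iff left_diff_distrib sum_subtractf)

lemma mat_act_zero [simp]: "mat_act (0\<^sub>m m n) = 0"
  by transfer (auto simp: fun_eq_iff)

lemma mat_act_mult:
  assumes "A \<in> carrier_mat m n" "B \<in> carrier_mat n p"
  shows "mat_act (A * B) = mat_act A * mat_act B"
  using assms
proof (transfer fixing: m n p, intro ext, goal_cases)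
  case (1 A B v i)
  show ?case
  proof (cases "i < m")
    case True
    have "(\<Sum>j<p. (A * B) $$ (i, j) * v j) = (\<Sum>j<p. \<Sum>k<n. A $$ (i, k) * (B $$ (k, j) * v j))"
      using 1 True
      by (auto simp: scalar_prod_def sum_distrib_right mult.assoc lessThan_atLeast0 intro!: sum.cong)
    also have "\<dots> = (\<Sum>k<n. A $$ (i, k) * (\<Sum>j<p. B $$ (k, j) * v j))"
      by (subst sum.swap) (simp add: sum_distrib_left)
    finally show ?thesis using 1 True by simp
  qed (use 1 in auto)
qed

lemma mat_act_inj:
  assumes "A \<in> carrier_mat m n" "B \<in> carrier_mat m n" "mat_act A = mat_act B"
  shows "A = B"
proof (rule eq_matI)
  fix i j assume ij: "i < dim_row B" "j < dim_col B"
  \<comment> \<open>Acting on the \<open>j\<close>-th basis vector reads off column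
    \<open>j\<close>.\<close>
  let ?v = "\<lambda>k. if k = j then 1 else 0"
  have "Rep_endo (mat_act C) ?v i = C $$ (i, j)" if "C \<in> carrier_mat m n" for C
    using that assms(2) ij by (simp add: mat_act.rep_eq if_distrib[of "(*) _"] cong: if_cong)
  from this[OF assms(1)] this[OF assms(2)] show "A $$ (i, j) = B $$ (i, j)"
    unfolding assms(3) by simp
qed (use assms in auto)

lemma endo_no_two_torsion:
  assumes "(2::'a::field) \<noteq> 0"
  shows "\<forall>x::'a endo. x + x = 0 \<longrightarrow> x = 0"
proof (intro allI impI)
  fix x :: "'a endo"
  assume "x + x = 0"
  then show "x = 0"
  proof (transfer, intro ext)
    fix f :: "(nat \<Rightarrow> 'a) \<Rightarrow> nat \<Rightarrow> 'a" and v i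
    assume "(\<lambda>v i. f v i + f v i) = (\<lambda>v i. 0)"
    then have "2 * f v i = 0" by (metis mult_2)
    with assms show "f v i = 0" by simp
  qed
qed

section \<open>Splitting the images of the matrix units\<close>

definition unit_mat :: "nat \<Rightarrow> nat \<Rightarrow> nat \<Rightarrow> 'a::zero_neq_one mat" where
  "unit_mat n i j = mat n n (\<lambda>(k, l). if k = i \<and> l = j then 1 else 0)"

lemma unit_mat_carrier [simp]: "unit_mat n i j \<in> carrier_mat n n"
  by (simp add: unit_mat_def)

lemma unit_mat_mult:
  assumes "i < n" "j < n" "k < n" "l < n"
  shows "unit_mat n i j * unit_mat n k l = (if j = k then unit_mat n i l else (0\<^sub>m n n :: 'a::comm_ring_1 mat))"
  using assms
  by (intro eq_matI) (auto simp: unit_mat_def scalar_prod_def if_distrib[of "\<lambda>x. _ * x"]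
      if_distrib[of "\<lambda>x. x * _"] sum.delta cong: if_cong)

text \<open>The units may all vanish, and the diagonal ones may add up to a proper idempotent; this
  accounts for zero multiplicities and for the zero block.\<close>

definition matrix_units :: "nat \<Rightarrow> nat \<Rightarrow> (nat \<Rightarrow> nat \<Rightarrow> 'a::semiring_0 mat) \<Rightarrow> bool" where
  "matrix_units n r M \<longleftrightarrow>
     (\<forall>i<n. \<forall>j<n. M i j \<in> carrier_mat r r) \<and>
     (\<forall>i<n. \<forall>j<n. \<forall>k<n. \<forall>l<n. M i j * M k l = (if j = k then M i l else 0\<^sub>m r r))"

lemma matrix_unit_systems:
  fixes \<Phi> :: "'a::field mat \<Rightarrow> 'a mat"
  assumes char_not_2: "(2::'a) \<noteq> 0"
    and maps_into: "\<And>A. A \<in> carrier_mat n n \<Longrightarrow> \<Phi> A \<in> carrier_mat r r"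
    and additive: "\<And>A B. A \<in> carrier_mat n n \<Longrightarrow> B \<in> carrier_mat n n \<Longrightarrow> \<Phi> (A + B) = \<Phi> A + \<Phi> B"
    and idem: "\<And>P. P \<in> carrier_mat n n \<Longrightarrow> idempotent_mat P \<Longrightarrow> idempotent_mat (\<Phi> P)"
  obtains M N :: "nat \<Rightarrow> nat \<Rightarrow> 'a mat"
  where "matrix_units n r M" "matrix_units n r N"
    and "\<forall>i<n. \<forall>j<n. \<forall>k<n. \<forall>l<n. M i j * N k l = 0\<^sub>m r r"
    and "\<forall>i<n. \<forall>j<n. \<forall>k<n. \<forall>l<n. N i j * M k l = 0\<^sub>m r r"
    and "\<forall>i<n. \<forall>j<n. \<Phi> (unit_mat n i j) = M i j + N j i"
proof -
  let ?u = "unit_mat n :: nat \<Rightarrow> nat \<Rightarrow> 'a mat"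
  \<comment> \<open>\<open>U\<close> represents the matrix units themselves, so idempotence of the
    test matrices becomes ring algebra with \<open>U_mult\<close>; \<open>E\<close> represents their
    images under \<open>\<Phi>\<close>.\<close>
  define U :: "nat \<Rightarrow> nat \<Rightarrow> 'a endo" where "U i j = mat_act (?u i j)" for i j
  define \<Psi> where "\<Psi> A = mat_act (\<Phi> A)" for A
  define E where "E i j = \<Psi> (?u i j)" for i j
  have U_mult: "U i j * U k l = (if j = k then U i l else 0)"
    if "i < n" "j < n" "k < n" "l < n" for i j k l
    using that unit_mat_mult[of i n j k l, where 'a = 'a]
    by (simp add: U_def mat_act_mult[of _ n n _ n, symmetric])
  have \<Psi>_add: "\<Psi> (A + B) = \<Psi> A + \<Psi> B" if "A \<in> carrier_mat n n" "B \<in> carrier_mat n n" for A B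
    using that by (simp add: \<Psi>_def additive mat_act_add[of _ r r] maps_into)
  have \<Psi>_diff: "\<Psi> (A - B) = \<Psi> A - \<Psi> B" if "A \<in> carrier_mat n n" "B \<in> carrier_mat n n" for A B
  proof -
    have "(A - B) + B = A" using that by (intro eq_matI) auto
    then show ?thesis
      using \<Psi>_add[OF minus_carrier_mat[OF that(2)] that(2)] by (metis add_diff_cancel_right')
  qed
  have \<Psi>_idem: "idem_elem (\<Psi> P)" if P: "P \<in> carrier_mat n n" "idem_elem (mat_act P)" for P
  proof -
    have "P * P = P"
      using P mat_act_inj[of "P * P" n n P] mat_act_mult[of P n n P n] by (simp add: idem_elem_def)
    then have "\<Phi> P * \<Phi> P = \<Phi> P"
      using idem P by (simp add: idempotent_mat_def)
    then show ?thesis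
      using mat_act_mult[of "\<Phi> P" r r "\<Phi> P" r] maps_into[OF P(1)] by (simp add: idem_elem_def \<Psi>_def)
  qed
  note push = \<Psi>_add \<Psi>_diff mat_act_add[of _ n n] mat_act_diff[of _ n n] add_carrier_mat minus_carrier_mat
  have J: "jordan_matrix_units E n"
  proof (rule jordan_matrix_units_of_idempotents, goal_cases)
    case 1 show ?case by (rule endo_no_two_torsion) (rule char_not_2)
  next
    case (2 i)
    then have "idem_elem (U i i)"
      by (simp add: U_mult idem_elem_def algebra_simps)
    then show ?case
      using \<Psi>_idem[of "?u i i"] by (simp add: E_def push flip: U_def)
  next
    case (3 i j)
    then have "idem_elem (U i i + U j j)"
      by (simp add: U_mult idem_elem_def algebra_simps)
    then show ?case
      using \<Psi>_idem[of "?u i i + ?u j j"] by (simp add: E_def push flip: U_def)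
  next
    case (4 i j)
    then have "idem_elem (U i i + U i j)"
      by (simp add: U_mult idem_elem_def algebra_simps)
    then show ?case
      using \<Psi>_idem[of "?u i i + ?u i j"] by (simp add: E_def push flip: U_def)
  next
    case (5 i j)
    then have "idem_elem (U i i - U i j)"
      by (simp add: U_mult idem_elem_def algebra_simps)
    then show ?case
      using \<Psi>_idem[of "?u i i - ?u i j"] by (simp add: E_def push flip: U_def)
  next
    case (6 i j)
    then have "idem_elem (U j j + U i j)"
      by (simp add: U_mult idem_elem_def algebra_simps)
    then show ?case
      using \<Psi>_idem[of "?u j j + ?u i j"] by (simp add: E_def push flip: U_def)
  next
    case (7 i j)
    then have "idem_elem (U j j - U i j)"
      by (simp add: U_mult idem_elem_def algebra_simps)
    then show ?case
      using \<Psi>_idem[of "?u j j - ?u i j"] by (simp add: E_def push flip: U_def)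
  next
    case (8 i j k)
    then have "idem_elem (U k k + (U i i + U i j))"
      by (simp add: U_mult idem_elem_def algebra_simps)
    then show ?case
      using \<Psi>_idem[of "?u k k + (?u i i + ?u i j)"] by (simp add: E_def push flip: U_def)
  next
    case (9 i j)
    then have "idem_elem (U i i + U i i - U j j + (U i j - (U j i + U j i)))"
      by (simp add: U_mult idem_elem_def algebra_simps)
    then show ?case
      using \<Psi>_idem[of "?u i i + ?u i i - ?u j j + (?u i j - (?u j i + ?u j i))"] by (simp add: E_def push flip: U_def)
  next
    case (10 i j k)
    then have "idem_elem (U j j + U i j + U j k + U i k)"
      by (simp add: U_mult idem_elem_def algebra_simps)
    then show ?case
      using \<Psi>_idem[of "?u j j + ?u i j + ?u j k + ?u i k"] by (simp add: E_def push flip: U_def)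
  next
    case (11 i j k)
    then have "idem_elem (U i i + U i j + U i k)"
      by (simp add: U_mult idem_elem_def algebra_simps)
    then show ?case
      using \<Psi>_idem[of "?u i i + ?u i j + ?u i k"] by (simp add: E_def push flip: U_def)
  next
    case (12 i j k)
    then have "idem_elem (U k k + U i k + U j k)"
      by (simp add: U_mult idem_elem_def algebra_simps)
    then show ?case
      using \<Psi>_idem[of "?u k k + ?u i k + ?u j k"] by (simp add: E_def push flip: U_def)
  qed
  \<comment> \<open>Membership in the image of the \<open>r\<close> by \<open>r\<close> matrices
    lets the split units be pulled back along the injective \<open>mat_act\<close>.\<close>
  define S where "S = (mat_act ` carrier_mat r r :: 'a endo set)"
  have S0: "0 \<in> S"
    unfolding S_def by (rule image_eqI[of _ _ "0\<^sub>m r r"]) simp_all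
  have S_mult: "x * y \<in> S" if "x \<in> S" "y \<in> S" for x y
    using that unfolding S_def by (auto simp flip: mat_act_mult)
  have S_E: "E i j \<in> S" for i j
    by (simp add: S_def E_def \<Psi>_def maps_into)
  show ?thesis
  proof (rule matrix_units_split[OF J S0 S_mult S_E], assumption, assumption, goal_cases)
    case (1 H G)
    note HG = this
    define M where "M i j = inv_into (carrier_mat r r) mat_act (H i j)" for i j
    define N where "N i j = inv_into (carrier_mat r r) mat_act (G i j)" for i j
    have c: "M i j \<in> carrier_mat r r" "N i j \<in> carrier_mat r r"
      and a: "mat_act (M i j) = H i j" "mat_act (N i j) = G i j" if "i < n" "j < n" for i j
      using HG(1,2)[OF that] unfolding M_def N_def S_def by (auto intro: inv_into_into f_inv_into_f)
    have eq: "X = Y" if "X \<in> carrier_mat r r" "Y \<in> carrier_mat r r" "mat_act X = mat_act Y" for X Y :: "'a mat"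
      using that by (rule mat_act_inj)
    show ?thesis
    proof (rule that[of M N])
      have "\<Phi> (?u i j) = M i j + N j i" if "i < n" "j < n" for i j
        using that HG(7)[OF that]
        by (intro eq) (auto simp: c a maps_into mat_act_add[of _ r r] E_def \<Psi>_def)
      then show "\<forall>i<n. \<forall>j<n. \<Phi> (?u i j) = M i j + N j i" by blast
    qed (auto simp: matrix_units_def c a HG mat_act_mult[of _ r r _ r] intro!: eq mult_carrier_mat[of _ r r])
  qed
qed

section \<open>Full rank factorization of idempotents\<close>

text \<open>Concatenations are encoded as four-block matrices with empty blocks, so that block
  multiplication applies to them.\<close>

definition hcat :: "'a::zero mat \<Rightarrow> 'a mat \<Rightarrow> 'a mat" where
  "hcat A B = four_block_mat A B (0\<^sub>m 0 (dim_col A)) (0\<^sub>m 0 (dim_col B))"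

definition vcat :: "'a::zero mat \<Rightarrow> 'a mat \<Rightarrow> 'a mat" where
  "vcat A B = four_block_mat A (0\<^sub>m (dim_row A) 0) B (0\<^sub>m (dim_row B) 0)"

lemma hcat_carrier [simp]:
  "A \<in> carrier_mat m k \<Longrightarrow> B \<in> carrier_mat m l \<Longrightarrow> hcat A B \<in> carrier_mat m (k + l)"
  unfolding hcat_def carrier_mat_def by simp

lemma vcat_carrier [simp]:
  "A \<in> carrier_mat k m \<Longrightarrow> B \<in> carrier_mat l m \<Longrightarrow> vcat A B \<in> carrier_mat (k + l) m"
  unfolding vcat_def carrier_mat_def by simp

lemma hcat_mult_vcat:
  fixes A B :: "'a::comm_ring_1 mat"
  assumes "A \<in> carrier_mat m k" "B \<in> carrier_mat m l" "X \<in> carrier_mat k p" "Y \<in> carrier_mat l p"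
  shows "hcat A B * vcat X Y = A * X + B * Y"
proof -
  have "hcat A B * vcat X Y = four_block_mat (A * X + B * Y) (0\<^sub>m m 0) (0\<^sub>m 0 p) (0\<^sub>m 0 0)"
    using assms unfolding hcat_def vcat_def
    by (subst mult_four_block_mat[of _ m k _ l _ 0 _ _ p _ 0]) auto
  then show ?thesis
    using assms by (auto intro!: eq_matI)
qed

lemma vcat_mult_hcat:
  fixes A B :: "'a::comm_ring_1 mat"
  assumes "A \<in> carrier_mat m k" "B \<in> carrier_mat m l" "X \<in> carrier_mat p m" "Y \<in> carrier_mat q m"
  shows "vcat X Y * hcat A B = four_block_mat (X * A) (X * B) (Y * A) (Y * B)"
  using assms unfolding hcat_def vcat_def
  by (subst mult_four_block_mat[of _ p m _ 0 _ q _ _ k _ l]) auto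

lemma hcat_mult_diag:
  fixes A B :: "'a::comm_ring_1 mat"
  assumes "A \<in> carrier_mat m k" "B \<in> carrier_mat m l" "X \<in> carrier_mat k k" "Y \<in> carrier_mat l l"
  shows "hcat A B * four_block_mat X (0\<^sub>m k l) (0\<^sub>m l k) Y = hcat (A * X) (B * Y)"
  using assms unfolding hcat_def
  by (subst mult_four_block_mat[of _ m k _ l _ 0 _ _ k _ l]) auto

lemma hcat_diag_vcat:
  fixes A B :: "'a::comm_ring_1 mat"
  assumes "A \<in> carrier_mat m k" "B \<in> carrier_mat m l" "X \<in> carrier_mat k k" "Y \<in> carrier_mat l l"
    "C \<in> carrier_mat k p" "D \<in> carrier_mat l p"
  shows "hcat A B * four_block_mat X (0\<^sub>m k l) (0\<^sub>m l k) Y * vcat C D = A * X * C + B * Y * D"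
  using assms by (simp add: hcat_mult_diag hcat_mult_vcat[of _ m k _ l _ p])

text \<open>From \<open>C * R = Q\<close> and \<open>R * C = 1\<close> one gets
  \<open>Q * C = C\<close> and \<open>R * Q = R\<close>, so whatever annihilates \<open>Q\<close>
  annihilates its factors.\<close>

lemma zero_if_right_inverse_factor:
  fixes Q :: "'a::comm_ring_1 mat"
  assumes "C \<in> carrier_mat r k" "R \<in> carrier_mat k r" "R * C = 1\<^sub>m k" "C * R = Q"
  shows "W \<in> carrier_mat m r \<Longrightarrow> W * Q = 0\<^sub>m m r \<Longrightarrow> W * C = 0\<^sub>m m k"
    and "V \<in> carrier_mat r m \<Longrightarrow> Q * V = 0\<^sub>m r m \<Longrightarrow> R * V = 0\<^sub>m k m"
proof -
  have Q: "Q \<in> carrier_mat r r" using assms by auto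
  have 1: "Q * C = C" "R * Q = R"
    using assms by (simp_all flip: assms(4)) (simp flip: assoc_mult_mat[of R k r C k R r])
  show "W * C = 0\<^sub>m m k" if "W \<in> carrier_mat m r" "W * Q = 0\<^sub>m m r"
    using that assms Q assoc_mult_mat[of W m r Q r C k] by (simp add: 1)
  show "R * V = 0\<^sub>m k m" if "V \<in> carrier_mat r m" "Q * V = 0\<^sub>m r m"
    using that assms Q assoc_mult_mat[of R k r Q r V m] by (simp add: 1)
qed

text \<open>
  Subtracting the rank one idempotent spanned by a nonzero column of \<open>P\<close> annihilates that column and
  keeps every zero column.
\<close>

lemma idempotent_full_rank_factorization:
  fixes P :: "'a::field mat"
  assumes "P \<in> carrier_mat r r" "P * P = P"
  obtains k C R where "C \<in> carrier_mat r k" "R \<in> carrier_mat k r" "R * C = 1\<^sub>m k" "C * R = P"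
  using assms
proof (induction "card {j. j < r \<and> (\<exists>i<r. P $$ (i, j) \<noteq> 0)}" arbitrary: P thesis rule: less_induct)
  case (less P)
  note P = less.prems(2,3)
  show ?case
  proof (cases "\<exists>i<r. \<exists>j<r. P $$ (i, j) \<noteq> 0")
    case False
    then have "P = 0\<^sub>m r r" using P(1) by (intro eq_matI) auto
    then show ?thesis
      by (intro less.prems(1)[of "0\<^sub>m r 0" 0 "0\<^sub>m 0 r"]) (auto intro!: eq_matI simp: scalar_prod_def)
  next
    case True
    then obtain i j where ij: "i < r" "j < r" "P $$ (i, j) \<noteq> 0" by blast
    \<comment> \<open>\<open>u\<close> is column \<open>j\<close>, and \<open>w\<close> is row
      \<open>i\<close> scaled by the pivot so that \<open>w * u = 1\<close>. Idempotence of
      \<open>P\<close> gives \<open>P * u = u\<close> and \<open>w * P = w\<close>.\<close>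
    define u where "u = mat r 1 (\<lambda>(x, _). P $$ (x, j))"
    define w where "w = mat 1 r (\<lambda>(_, y). P $$ (i, y) / P $$ (i, j))"
    have uwc: "u \<in> carrier_mat r 1" "w \<in> carrier_mat 1 r"
      unfolding u_def w_def by (rule mat_carrier)+
    note One_nat_def [simp del]
    have PP: "(\<Sum>k<r. P $$ (x, k) * P $$ (k, y)) = P $$ (x, y)" if "x < r" "y < r" for x y
      using arg_cong[OF P(2), of "\<lambda>A. A $$ (x, y)"] P(1) that
      by (simp add: scalar_prod_def lessThan_atLeast0)
    have Pu: "P * u = u"
      using P(1) ij by (intro eq_matI) (auto simp: u_def scalar_prod_def PP simp flip: lessThan_atLeast0)
    have wP: "w * P = w"
      using P(1) ij by (intro eq_matI)
        (auto simp: w_def scalar_prod_def PP simp flip: lessThan_atLeast0 sum_divide_distrib)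
    have wu: "w * u = 1\<^sub>m 1"
      using P(1) ij by (intro eq_matI)
        (auto simp: u_def w_def scalar_prod_def PP simp flip: lessThan_atLeast0 sum_divide_distrib)
    define Q where "Q = P - u * w"
    have uw [simp]: "u * w \<in> carrier_mat r r" by (rule mult_carrier_mat[of _ r 1]) (rule uwc)+
    have Q: "Q \<in> carrier_mat r r" using uwc P(1) by (simp add: Q_def minus_carrier_mat)
    have wQ: "w * Q = 0\<^sub>m 1 r"
      using uwc P(1) by (simp add: Q_def mult_minus_distrib_mat[of _ 1 r] wP wu minus_r_inv_mat[of w 1 r] flip: assoc_mult_mat[of w 1 r u 1 w r])
    have Qu: "Q * u = 0\<^sub>m r 1"
      using uwc P(1) by (simp add: Q_def minus_mult_distrib_mat[of _ r r] Pu wu assoc_mult_mat[of _ r 1])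
    have PQ: "P * Q = Q"
      using uwc P by (simp add: Q_def mult_minus_distrib_mat[of _ r r] Pu flip: assoc_mult_mat[of P r r u 1 w r])
    have "Q * Q = P * Q - u * w * Q"
      using uwc P(1) Q by (simp add: minus_mult_distrib_mat[of _ r r] Q_def del: assoc_mult_mat)
    also have "u * w * Q = 0\<^sub>m r r"
      using uwc Q by (simp add: assoc_mult_mat[of u r 1 w r Q r] wQ)
    finally have QQ: "Q * Q = Q" using Q PQ by auto
    have Q_entry: "Q $$ (x, y) = P $$ (x, y) - P $$ (x, j) * (P $$ (i, y) / P $$ (i, j))"
      if "x < r" "y < r" for x y
      using that P(1) uwc by (simp add: Q_def u_def w_def scalar_prod_def)
    have "{y. y < r \<and> (\<exists>x<r. Q $$ (x, y) \<noteq> 0)} \<subset> {y. y < r \<and> (\<exists>x<r. P $$ (x, y) \<noteq> 0)}"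
    proof
      show "{y. y < r \<and> (\<exists>x<r. Q $$ (x, y) \<noteq> 0)} \<subseteq> {y. y < r \<and> (\<exists>x<r. P $$ (x, y) \<noteq> 0)}"
      proof clarify
        fix y x assume xy: "y < r" "x < r" "Q $$ (x, y) \<noteq> 0"
        then have "P $$ (x, y) \<noteq> 0 \<or> P $$ (i, y) \<noteq> 0"
          by (auto simp: Q_entry)
        then show "\<exists>x<r. P $$ (x, y) \<noteq> 0"
          using xy(2) ij(1) by blast
      qed
      have "j \<notin> {y. y < r \<and> (\<exists>x<r. Q $$ (x, y) \<noteq> 0)}" "j \<in> {y. y < r \<and> (\<exists>x<r. P $$ (x, y) \<noteq> 0)}"
        using ij by (auto simp: Q_entry)
      then show "{y. y < r \<and> (\<exists>x<r. Q $$ (x, y) \<noteq> 0)} \<noteq> {y. y < r \<and> (\<exists>x<r. P $$ (x, y) \<noteq> 0)}"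
        by metis
    qed
    then have "card {y. y < r \<and> (\<exists>x<r. Q $$ (x, y) \<noteq> 0)} < card {y. y < r \<and> (\<exists>x<r. P $$ (x, y) \<noteq> 0)}"
      by (intro psubset_card_mono) auto
    from less.hyps[OF this _ Q QQ] obtain k C R where
      CR: "C \<in> carrier_mat r k" "R \<in> carrier_mat k r" "R * C = 1\<^sub>m k" "C * R = Q"
      by blast
    \<comment> \<open>By this orthogonality, prepending \<open>u\<close> to the columns of
      \<open>C\<close> and \<open>w\<close> to the rows of \<open>R\<close> keeps the two
      dual.\<close>
    have "w * C = 0\<^sub>m 1 k" "R * u = 0\<^sub>m k 1"
      using zero_if_right_inverse_factor[OF CR] wQ Qu uwc by blast+
    then have "vcat w R * hcat u C = 1\<^sub>m (1 + k)"
      using uwc CR by (simp add: vcat_mult_hcat[of _ r 1 _ k _ 1 _ k] wu)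
    moreover have "hcat u C * vcat w R = P"
      using uwc CR P(1) by (subst hcat_mult_vcat[of _ r 1 _ k _ r]) (auto simp: Q_def)
    ultimately show ?thesis
      using uwc CR by (intro less.prems(1)[of "hcat u C" "1 + k" "vcat w R"]) auto
  qed
qed

text \<open>If \<open>m > k\<close>, padding with zeros gives square matrices with
  \<open>?A * ?B = 1\<close>, hence \<open>?B * ?A = 1\<close>; but the latter product has the entry
  0 at \<open>(k, k)\<close>.\<close>

lemma invertible_imp_square:
  fixes A B :: "'a::field mat"
  assumes A: "A \<in> carrier_mat m k" and B: "B \<in> carrier_mat k m"
    and AB: "A * B = 1\<^sub>m m" and BA: "B * A = 1\<^sub>m k"
  shows "m = k"
proof -
  have le: "m \<le> k" if A: "A \<in> carrier_mat m k" and B: "B \<in> carrier_mat k m" and AB: "A * B = 1\<^sub>m m"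
    for A B :: "'a mat" and m k
  proof (rule ccontr)
    assume "\<not> m \<le> k"
    then obtain d where d: "m = k + d" "d > 0" by (metis le_add_diff_inverse nat_le_linear not_le zero_less_diff)
    let ?A = "hcat A (0\<^sub>m m d)" and ?B = "vcat B (0\<^sub>m d m)"
    have "?A * ?B = 1\<^sub>m m"
      using A B AB by (subst hcat_mult_vcat[of _ m k _ d _ m]) auto
    moreover have c: "?A \<in> carrier_mat m m" "?B \<in> carrier_mat m m"
      using A B d by auto
    ultimately have "?B * ?A = 1\<^sub>m m"
      using mat_mult_left_right_inverse by blast
    moreover have "?B * ?A = four_block_mat (B * A) (0\<^sub>m k d) (0\<^sub>m d k) (0\<^sub>m d d)"
      using A B by (subst vcat_mult_hcat[of _ m k _ d _ k _ d]) auto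
    moreover have "four_block_mat (B * A) (0\<^sub>m k d) (0\<^sub>m d k) (0\<^sub>m d d) $$ (k, k) = 0"
      using A B d by auto
    ultimately have "(1\<^sub>m m :: 'a mat) $$ (k, k) = 0" by metis
    then show False using d by simp
  qed
  show ?thesis using le[OF A B AB] le[OF B A BA] by simp
qed

section \<open>Block form of a system of matrix units\<close>

text \<open>A position \<open>c = a * n + i\<close> in \<open>kron_id\<close> means index
  \<open>i\<close> inside copy \<open>a\<close>; sums over positions become double sums.\<close>

lemma sum_div_mod:
  fixes f :: "nat \<Rightarrow> nat \<Rightarrow> 'b::comm_monoid_add"
  shows "(\<Sum>c<k * n. f (c div n) (c mod n)) = (\<Sum>a<k. \<Sum>i<n. f a i)"
proof -
  have "(\<Sum>c<k * n. f (c div n) (c mod n)) = (\<Sum>a<k. \<Sum>c\<in>{a * n..<a * n + n}. f (c div n) (c mod n))"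
    by (simp add: sum.nat_group)
  also have "\<dots> = (\<Sum>a<k. \<Sum>i<n. f a i)"
  proof (rule sum.cong[OF refl])
    fix a
    show "(\<Sum>c\<in>{a * n..<a * n + n}. f (c div n) (c mod n)) = (\<Sum>i<n. f a i)"
    proof (rule sum.reindex_bij_witness[of _ "\<lambda>i. a * n + i" "\<lambda>c. c - a * n"], goal_cases)
      case (5 c)
      then have "c div n = a" by (intro div_nat_eqI) (auto simp: mult.commute)
      then show ?case by (simp add: modulo_nat_def mult.commute)
    qed auto
  qed
  finally show ?thesis .
qed

lemma div_less_of_less_mult: "c < k * n \<Longrightarrow> c div n < k" for c k n :: nat
  by (simp add: less_mult_imp_div_less)

lemma mod_less_of_less_mult: "c < k * n \<Longrightarrow> c mod n < n" for c k n :: nat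
  by (cases "n = 0") auto

section \<open>Algebra of the repeated block matrices\<close>

lemma kron_id_carrier [simp]: "A \<in> carrier_mat m n \<Longrightarrow> kron_id k A \<in> carrier_mat (k * m) (k * n)"
  by (simp add: kron_id_def)

lemma kron_id_index:
  assumes "A \<in> carrier_mat n n" "p < k * n" "q < k * n"
  shows "kron_id k A $$ (p, q) = (if p div n = q div n then A $$ (p mod n, q mod n) else 0)"
  using carrier_matD[OF assms(1)] assms(2,3) by (simp add: kron_id_def)

lemma kron_id_add:
  fixes A B :: "'a::monoid_add mat"
  shows "A \<in> carrier_mat n n \<Longrightarrow> B \<in> carrier_mat n n \<Longrightarrow> kron_id k (A + B) = kron_id k A + kron_id k B"
  by (intro eq_matI) (auto simp: kron_id_def mod_less_of_less_mult)

lemma kron_id_smult: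
  fixes A :: "'a::mult_zero mat"
  shows "A \<in> carrier_mat n n \<Longrightarrow> kron_id k (c \<cdot>\<^sub>m A) = c \<cdot>\<^sub>m kron_id k A"
  by (intro eq_matI) (auto simp: kron_id_def mod_less_of_less_mult)

lemma kron_id_mult:
  fixes A B :: "'a::comm_ring_1 mat"
  assumes "A \<in> carrier_mat n n" "B \<in> carrier_mat n n"
  shows "kron_id k (A * B) = kron_id k A * kron_id k B"
proof (rule eq_matI, goal_cases)
  case (1 p q)
  with assms have pq: "p < k * n" "q < k * n" by (auto simp: kron_id_def)
  have "(kron_id k A * kron_id k B) $$ (p, q) = (\<Sum>c<k * n.
      (if p div n = c div n then A $$ (p mod n, c mod n) else 0) *
      (if c div n = q div n then B $$ (c mod n, q mod n) else 0))"
    using kron_id_carrier[OF assms(1), of k] kron_id_carrier[OF assms(2), of k] pq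
    by (simp add: kron_id_index[OF assms(1)] kron_id_index[OF assms(2)] scalar_prod_def lessThan_atLeast0)
  also have "\<dots> = (\<Sum>a<k. \<Sum>i<n. (if p div n = a then A $$ (p mod n, i) else 0) *
      (if a = q div n then B $$ (i, q mod n) else 0))"
    by (rule sum_div_mod)
  also have "\<dots> = (\<Sum>a<k. if a = p div n then
      (if p div n = q div n then \<Sum>i<n. A $$ (p mod n, i) * B $$ (i, q mod n) else 0) else 0)"
    by (rule sum.cong) auto
  also have "\<dots> = kron_id k (A * B) $$ (p, q)"
    using assms pq
    by (simp add: kron_id_index[of _ n] scalar_prod_def lessThan_atLeast0 div_less_of_less_mult mod_less_of_less_mult)
  finally show ?case ..
qed (use assms in \<open>auto simp: kron_id_def\<close>)

text \<open>The columns of the \<open>F i\<close> are interleaved rather than juxtaposed: position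
  \<open>a * n + i\<close> holds column \<open>a\<close> of \<open>F i\<close>, to match the
  positions in \<open>kron_id\<close>.\<close>

definition stack_cols :: "nat \<Rightarrow> nat \<Rightarrow> nat \<Rightarrow> (nat \<Rightarrow> 'a mat) \<Rightarrow> 'a mat" where
  "stack_cols r k n F = mat r (k * n) (\<lambda>(x, c). F (c mod n) $$ (x, c div n))"

definition stack_rows :: "nat \<Rightarrow> nat \<Rightarrow> nat \<Rightarrow> (nat \<Rightarrow> 'a mat) \<Rightarrow> 'a mat" where
  "stack_rows r k n G = mat (k * n) r (\<lambda>(d, y). G (d mod n) $$ (d div n, y))"

lemma stack_carrier [simp]:
  "stack_cols r k n F \<in> carrier_mat r (k * n)" "stack_rows r k n G \<in> carrier_mat (k * n) r"
  by (simp_all add: stack_cols_def stack_rows_def)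

lemma mult_stack_cols:
  fixes W :: "'a::comm_ring_1 mat"
  assumes "\<And>i. i < n \<Longrightarrow> F i \<in> carrier_mat r k" "W \<in> carrier_mat m r"
  shows "W * stack_cols r k n F = stack_cols m k n (\<lambda>i. W * F i)"
proof (rule eq_matI, goal_cases)
  case (1 x c)
  then have "x < m" "c < k * n" by (auto simp: stack_cols_def)
  with assms(1)[of "c mod n"] assms(2) show ?case
    by (simp add: stack_cols_def scalar_prod_def div_less_of_less_mult mod_less_of_less_mult)
qed (use assms in \<open>auto simp: stack_cols_def\<close>)

lemma stack_rows_mult:
  fixes V :: "'a::comm_ring_1 mat"
  assumes "\<And>i. i < n \<Longrightarrow> G i \<in> carrier_mat k r" "V \<in> carrier_mat r m"
  shows "stack_rows r k n G * V = stack_rows m k n (\<lambda>i. G i * V)"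
proof (rule eq_matI, goal_cases)
  case (1 d y)
  then have "y < m" "d < k * n" by (auto simp: stack_rows_def)
  with assms(1)[of "d mod n"] assms(2) show ?case
    by (simp add: stack_rows_def scalar_prod_def div_less_of_less_mult mod_less_of_less_mult)
qed (use assms in \<open>auto simp: stack_rows_def\<close>)

lemma stack_cols_kron_unit:
  fixes F :: "nat \<Rightarrow> 'a::comm_ring_1 mat"
  assumes F: "\<And>i. i < n \<Longrightarrow> F i \<in> carrier_mat r k" and ij: "i < n" "j < n"
  shows "stack_cols r k n F * kron_id k (unit_mat n i j)
    = stack_cols r k n (\<lambda>l. if l = j then F i else 0\<^sub>m r k)"
proof (rule eq_matI, goal_cases)
  case (1 x d)
  then have xd: "x < r" "d < k * n" by (auto simp: stack_cols_def)
  have K: "kron_id k (unit_mat n i j :: 'a mat) \<in> carrier_mat (k * n) (k * n)"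
    by simp
  have "(stack_cols r k n F * kron_id k (unit_mat n i j)) $$ (x, d) = (\<Sum>c<k * n.
      F (c mod n) $$ (x, c div n) * (if c div n = d div n then if c mod n = i \<and> d mod n = j then 1 else 0 else 0))"
    using xd carrier_matD[OF K]
    by (simp add: kron_id_index[OF unit_mat_carrier] stack_cols_def scalar_prod_def lessThan_atLeast0)
      (auto simp: unit_mat_def mod_less_of_less_mult intro!: sum.cong)
  also have "\<dots> = (\<Sum>a<k. \<Sum>l<n. F l $$ (x, a) * (if a = d div n then if l = i \<and> d mod n = j then 1 else 0 else 0))"
    by (rule sum_div_mod)
  also have "\<dots> = (\<Sum>a<k. if a = d div n then
      (\<Sum>l<n. if l = i then (if d mod n = j then F l $$ (x, a) else 0) else 0) else 0)"
    using ij by (intro sum.cong refl) (auto simp: if_distrib[of "(*) _"] cong: if_cong)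
  also have "\<dots> = (if d mod n = j then F i $$ (x, d div n) else 0)"
    using ij xd by (simp add: div_less_of_less_mult)
  also have "\<dots> = stack_cols r k n (\<lambda>l. if l = j then F i else 0\<^sub>m r k) $$ (x, d)"
    using xd by (simp add: stack_cols_def div_less_of_less_mult)
  finally show ?case .
qed (simp_all add: stack_cols_def kron_id_def unit_mat_def)

lemma stack_cols_mult_stack_rows:
  fixes F G :: "nat \<Rightarrow> 'a::comm_ring_1 mat"
  assumes F: "\<And>i. i < n \<Longrightarrow> F i \<in> carrier_mat r k" and G: "\<And>i. i < n \<Longrightarrow> G i \<in> carrier_mat k r"
    and j: "j < n" and F0: "\<And>i. i < n \<Longrightarrow> i \<noteq> j \<Longrightarrow> F i = 0\<^sub>m r k"
  shows "stack_cols r k n F * stack_rows r k n G = F j * G j"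
proof (rule eq_matI, goal_cases)
  case (1 x y)
  then have xy: "x < r" "y < r" using F G j by auto
  have "(stack_cols r k n F * stack_rows r k n G) $$ (x, y) =
      (\<Sum>c<k * n. F (c mod n) $$ (x, c div n) * G (c mod n) $$ (c div n, y))"
    using xy by (simp add: stack_cols_def stack_rows_def scalar_prod_def lessThan_atLeast0)
  also have "\<dots> = (\<Sum>a<k. \<Sum>l<n. F l $$ (x, a) * G l $$ (a, y))"
    by (rule sum_div_mod)
  also have "\<dots> = (\<Sum>a<k. \<Sum>l<n. if l = j then F j $$ (x, a) * G j $$ (a, y) else 0)"
    using xy by (intro sum.cong refl) (auto simp: F0)
  also have "\<dots> = (F j * G j) $$ (x, y)"
    using xy j F[OF j] G[OF j] by (simp add: scalar_prod_def lessThan_atLeast0)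
  finally show ?case .
qed (use F G j in \<open>auto simp: stack_cols_def stack_rows_def\<close>)

text \<open>The last two conclusions hold because \<open>C\<close> is built from columns of the
  \<open>M i 0 * D\<close> and \<open>R\<close> from rows of the \<open>S * M 0 j\<close>, with
  \<open>M 0 0 = D * S\<close>. They carry the mutual annihilation of two systems over to their
  realizations.\<close>

lemma matrix_units_realization:
  fixes M :: "nat \<Rightarrow> nat \<Rightarrow> 'a::field mat"
  assumes "matrix_units n r M"
  obtains k C R where "C \<in> carrier_mat r (k * n)" "R \<in> carrier_mat (k * n) r" "R * C = 1\<^sub>m (k * n)"
    and "\<forall>i<n. \<forall>j<n. C * kron_id k (unit_mat n i j) * R = M i j"
    and "\<forall>m. \<forall>W \<in> carrier_mat m r. (\<forall>i<n. W * M i 0 = 0\<^sub>m m r) \<longrightarrow> W * C = 0\<^sub>m m (k * n)"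
    and "\<forall>m. \<forall>V \<in> carrier_mat r m. (\<forall>j<n. M 0 j * V = 0\<^sub>m r m) \<longrightarrow> R * V = 0\<^sub>m (k * n) m"
proof -
  have M: "M i j \<in> carrier_mat r r" if "i < n" "j < n" for i j
    using assms that by (simp add: matrix_units_def)
  have M_mult: "M i j * M k l = (if j = k then M i l else 0\<^sub>m r r)"
    if "i < n" "j < n" "k < n" "l < n" for i j k l
    using assms that by (simp add: matrix_units_def)
  \<comment> \<open>For \<open>n = 0\<close> nothing is known about \<open>M 0 0\<close>, so a
    default idempotent replaces it.\<close>
  define f where "f = (if n = 0 then 0\<^sub>m r r else M 0 0)"
  have f: "f \<in> carrier_mat r r" "f * f = f"
    using M[of 0 0] M_mult[of 0 0 0 0] by (auto simp: f_def)
  then obtain k D S where D: "D \<in> carrier_mat r k" and S: "S \<in> carrier_mat k r"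
    and SD: "S * D = 1\<^sub>m k" and DS: "D * S = f"
    by (rule idempotent_full_rank_factorization)
  define C where "C = stack_cols r k n (\<lambda>i. M i 0 * D)"
  define R where "R = stack_rows r k n (\<lambda>i. S * M 0 i)"
  have c: "M i 0 \<in> carrier_mat r r" "M 0 i \<in> carrier_mat r r"
    "M i 0 * D \<in> carrier_mat r k" "S * M 0 i \<in> carrier_mat k r" if "i < n" for i
    using M[of i 0] M[of 0 i] D S that by auto
  have CR: "C \<in> carrier_mat r (k * n)" "R \<in> carrier_mat (k * n) r"
    by (simp_all add: C_def R_def)
  moreover have "R * C = 1\<^sub>m (k * n)"
  proof (rule eq_matI, goal_cases)
    case (1 d e)
    then have de: "d < k * n" "e < k * n" by auto
    let ?i = "d mod n" and ?j = "e mod n"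
    have ij: "?i < n" "?j < n" using de by (auto intro: mod_less_of_less_mult)
    then have n: "0 < n" by simp
    \<comment> \<open>The remainders select the units, the quotients the entry of
      \<open>S * (M 0 ?i * M ?j 0 * D)\<close>, which is \<open>S * f * D = 1\<close> for
      \<open>?i = ?j\<close> and 0 otherwise.\<close>
    have "(R * C) $$ (d, e) = (S * M 0 ?i * C) $$ (d div n, e)"
      unfolding R_def using c CR(1) de ij
      by (subst stack_rows_mult[of n _ k r _ "k * n"]) (auto simp: stack_rows_def)
    also have "\<dots> = (S * M 0 ?i * (M ?j 0 * D)) $$ (d div n, e div n)"
      unfolding C_def using c de ij
      by (subst mult_stack_cols[of n _ r k _ k]) (auto simp: stack_cols_def div_less_of_less_mult)
    also have "S * M 0 ?i * (M ?j 0 * D) = S * (M 0 ?i * M ?j 0 * D)"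
      using c[OF ij(1)] c[OF ij(2)] S D
      by (simp add: assoc_mult_mat[of S k r _ r _ k] assoc_mult_mat[of _ r r _ r _ k])
    also have "M 0 ?i * M ?j 0 = (if ?i = ?j then f else 0\<^sub>m r r)"
      using ij n M_mult[of 0 ?i ?j 0] by (simp add: f_def)
    also have "S * (\<dots> * D) = (if ?i = ?j then 1\<^sub>m k else 0\<^sub>m k k)"
      using S D f(1) SD by (auto simp: assoc_mult_mat[of D r k S r D k] simp flip: DS)
    also have "\<dots> $$ (d div n, e div n) = 1\<^sub>m (k * n) $$ (d, e)"
      using de by (auto simp: div_less_of_less_mult) (metis div_mult_mod_eq)
    finally show ?case .
  qed (use CR in auto)
  moreover have "C * kron_id k (unit_mat n i j) * R = M i j" if ij: "i < n" "j < n" for i j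
  proof -
    \<comment> \<open>The middle factor moves block \<open>i\<close> of \<open>C\<close> to slot
      \<open>j\<close> and clears the rest, so only block \<open>j\<close> of \<open>R\<close> is
      met.\<close>
    have "C * kron_id k (unit_mat n i j) * R = M i 0 * D * (S * M 0 j)"
      unfolding C_def R_def using c ij
      by (subst stack_cols_kron_unit, simp_all, subst stack_cols_mult_stack_rows[of n _ r k _ j]) auto
    also have "\<dots> = M i 0 * (D * S) * M 0 j"
      using c[OF ij(1)] c[OF ij(2)] S D
      by (simp add: assoc_mult_mat[of _ r r D k _ r] assoc_mult_mat[of D r k S r _ r] assoc_mult_mat[of _ r r _ r _ r])
    also have "\<dots> = M i j"
      using ij M_mult[of i 0 0 0] M_mult[of i 0 0 j] by (simp add: DS f_def)
    finally show ?thesis .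
  qed
  moreover have "W * C = 0\<^sub>m m (k * n)"
    if W: "W \<in> carrier_mat m r" and W0: "\<And>i. i < n \<Longrightarrow> W * M i 0 = 0\<^sub>m m r" for m W
  proof -
    have "W * (M i 0 * D) = 0\<^sub>m m k" if "i < n" for i
      using assoc_mult_mat[OF W c(1)[OF that] D] W0[OF that] D by simp
    then show ?thesis
      unfolding C_def using c W
      by (subst mult_stack_cols[of n _ r k _ m])
        (auto intro!: eq_matI simp: stack_cols_def div_less_of_less_mult mod_less_of_less_mult)
  qed
  moreover have "R * V = 0\<^sub>m (k * n) m"
    if V: "V \<in> carrier_mat r m" and V0: "\<And>j. j < n \<Longrightarrow> M 0 j * V = 0\<^sub>m r m" for m V
  proof -
    have "S * M 0 i * V = 0\<^sub>m k m" if "i < n" for i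
      using assoc_mult_mat[OF S c(2)[OF that] V] V0[OF that] S by simp
    then show ?thesis
      unfolding R_def using c V
      by (subst stack_rows_mult[of n _ k r _ m])
        (auto intro!: eq_matI simp: stack_rows_def div_less_of_less_mult mod_less_of_less_mult)
  qed
  ultimately show ?thesis by (intro that) blast+
qed

lemma linear_eq_on_unit_mats:
  fixes F G :: "'a::field mat \<Rightarrow> 'a mat"
  assumes F: "\<And>A. A \<in> carrier_mat n n \<Longrightarrow> F A \<in> carrier_mat r r"
      "\<And>A B. A \<in> carrier_mat n n \<Longrightarrow> B \<in> carrier_mat n n \<Longrightarrow> F (A + B) = F A + F B"
      "\<And>c A. A \<in> carrier_mat n n \<Longrightarrow> F (c \<cdot>\<^sub>m A) = c \<cdot>\<^sub>m F A"
    and G: "\<And>A. A \<in> carrier_mat n n \<Longrightarrow> G A \<in> carrier_mat r r"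
      "\<And>A B. A \<in> carrier_mat n n \<Longrightarrow> B \<in> carrier_mat n n \<Longrightarrow> G (A + B) = G A + G B"
      "\<And>c A. A \<in> carrier_mat n n \<Longrightarrow> G (c \<cdot>\<^sub>m A) = c \<cdot>\<^sub>m G A"
    and eq: "\<And>i j. i < n \<Longrightarrow> j < n \<Longrightarrow> F (unit_mat n i j) = G (unit_mat n i j)"
    and A: "A \<in> carrier_mat n n"
  shows "F A = G A"
proof -
  \<comment> \<open>\<open>P T\<close> is \<open>A\<close> cut down to the positions in
    \<open>T\<close>; induction on \<open>T\<close> adds one entry at a time.\<close>
  define P where "P T = mat n n (\<lambda>p. if p \<in> T then A $$ p else 0)" for T
  have P: "P T \<in> carrier_mat n n" for T by (simp add: P_def)
  have "F (P T) = G (P T)" if "finite T" "T \<subseteq> {..<n} \<times> {..<n}" for T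
    using that
  proof (induction T rule: finite_induct)
    case empty
    have "P {} = 0 \<cdot>\<^sub>m P {}" by (intro eq_matI) (auto simp: P_def)
    moreover have "F (0 \<cdot>\<^sub>m P {}) = 0\<^sub>m r r" "G (0 \<cdot>\<^sub>m P {}) = 0\<^sub>m r r"
      using F(1)[OF P, of "{}"] G(1)[OF P, of "{}"] by (auto simp: F(3) G(3) P intro!: eq_matI)
    ultimately show ?case by simp
  next
    case (insert p T)
    obtain i j where p: "p = (i, j)" by force
    with insert have ij: "i < n" "j < n" by auto
    have "P (insert p T) = P T + A $$ (i, j) \<cdot>\<^sub>m unit_mat n i j"
      using insert(2) by (intro eq_matI) (auto simp: P_def unit_mat_def p)
    with insert ij show ?case
      by (simp add: F G P eq)
  qed
  from this[of "{..<n} \<times> {..<n}"] have "F (P ({..<n} \<times> {..<n})) = G (P ({..<n} \<times> {..<n}))" by simp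
  moreover have "P ({..<n} \<times> {..<n}) = A"
    using A by (intro eq_matI) (auto simp: P_def)
  ultimately show ?thesis by simp
qed

section \<open>Block form of the map\<close>

lemma transpose_unit_mat: "transpose_mat (unit_mat n i j) = unit_mat n j i"
  by (intro eq_matI) (auto simp: unit_mat_def)

text \<open>The normal form without its zero block, whose size emerges only when the change of basis
  is completed.\<close>

definition jordan_diag :: "nat \<Rightarrow> nat \<Rightarrow> nat \<Rightarrow> 'a::zero mat \<Rightarrow> 'a mat" where
  "jordan_diag n k1 k2 A = four_block_mat (kron_id k1 A) (0\<^sub>m (k1 * n) (k2 * n))
     (0\<^sub>m (k2 * n) (k1 * n)) (kron_id k2 (transpose_mat A))"

lemma jordan_diag_carrier [simp]:
  "A \<in> carrier_mat n n \<Longrightarrow> jordan_diag n k1 k2 A \<in> carrier_mat (k1 * n + k2 * n) (k1 * n + k2 * n)"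
  by (simp add: jordan_diag_def four_block_carrier_mat)

lemma jordan_diag_add:
  fixes A B :: "'a::comm_ring_1 mat"
  assumes "A \<in> carrier_mat n n" "B \<in> carrier_mat n n"
  shows "jordan_diag n k1 k2 (A + B) = jordan_diag n k1 k2 A + jordan_diag n k1 k2 B"
  using assms unfolding jordan_diag_def
  by (subst add_four_block_mat[of _ "k1 * n" "k1 * n" _ "k2 * n" _ "k2 * n"])
    (simp_all add: transpose_add[of _ n n] kron_id_add[of _ n])

lemma jordan_diag_smult:
  fixes A :: "'a::comm_ring_1 mat"
  assumes "A \<in> carrier_mat n n"
  shows "jordan_diag n k1 k2 (c \<cdot>\<^sub>m A) = c \<cdot>\<^sub>m jordan_diag n k1 k2 A"
proof -
  have "transpose_mat (c \<cdot>\<^sub>m A) = c \<cdot>\<^sub>m transpose_mat A"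
    by (intro eq_matI) auto
  with assms show ?thesis unfolding jordan_diag_def
    by (subst smult_four_block_mat[of _ "k1 * n" "k1 * n" _ "k2 * n" _ "k2 * n"])
      (simp_all add: kron_id_smult[of _ n])
qed

text \<open>Transposition reverses products, so the lower block of a product contains the transpose
  of \<open>B * A\<close>; symmetrizing restores agreement with the upper block.\<close>

lemma jordan_diag_jordan:
  fixes A B :: "'a::comm_ring_1 mat"
  assumes "A \<in> carrier_mat n n" "B \<in> carrier_mat n n"
  shows "jordan_diag n k1 k2 (A * B + B * A)
    = jordan_diag n k1 k2 A * jordan_diag n k1 k2 B + jordan_diag n k1 k2 B * jordan_diag n k1 k2 A"
proof -
  have prod: "jordan_diag n k1 k2 A * jordan_diag n k1 k2 B = four_block_mat (kron_id k1 (A * B))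
      (0\<^sub>m (k1 * n) (k2 * n)) (0\<^sub>m (k2 * n) (k1 * n)) (kron_id k2 (transpose_mat (B * A)))"
    if "A \<in> carrier_mat n n" "B \<in> carrier_mat n n" for A B :: "'a mat"
    using kron_id_carrier[OF that(1), of k1] kron_id_carrier[OF that(2), of k1]
      kron_id_carrier[of "transpose_mat A" n n k2] kron_id_carrier[of "transpose_mat B" n n k2] that
    unfolding jordan_diag_def
    by (subst mult_four_block_mat[of _ "k1 * n" "k1 * n" _ "k2 * n" _ "k2 * n" _ _ "k1 * n" _ "k2 * n"])
      (simp_all add: kron_id_mult[of _ n] transpose_mult[of B n n A n] del: kron_id_carrier)
  have c: "A * B \<in> carrier_mat n n" "B * A \<in> carrier_mat n n"
    using assms by auto
  have "jordan_diag n k1 k2 A * jordan_diag n k1 k2 B + jordan_diag n k1 k2 B * jordan_diag n k1 k2 A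
      = four_block_mat (kron_id k1 (A * B) + kron_id k1 (B * A))
          (0\<^sub>m (k1 * n) (k2 * n)) (0\<^sub>m (k2 * n) (k1 * n))
          (kron_id k2 (transpose_mat (B * A)) + kron_id k2 (transpose_mat (A * B)))"
    unfolding prod[OF assms] prod[OF assms(2,1)]
    using c by (subst add_four_block_mat[of _ "k1 * n" "k1 * n" _ "k2 * n" _ "k2 * n"]) simp_all
  also have "\<dots> = jordan_diag n k1 k2 (A * B + B * A)"
    using c by (simp add: jordan_diag_def kron_id_add[of _ n] transpose_add[of _ n n]
      comm_add_mat[of "kron_id k2 (transpose_mat (B * A))" "k2 * n" "k2 * n"])
  finally show ?thesis ..
qed

theorem theorem4p5:
  fixes \<Phi> :: "'a::field mat \<Rightarrow> 'a mat" and n r :: nat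
  assumes char_not_2: "(2::'a) \<noteq> 0"
    and maps_into: "\<And>A. A \<in> carrier_mat n n \<Longrightarrow> \<Phi> A \<in> carrier_mat r r"
    and additive: "\<And>A B. A \<in> carrier_mat n n \<Longrightarrow> B \<in> carrier_mat n n \<Longrightarrow> \<Phi> (A + B) = \<Phi> A + \<Phi> B"
    and homogeneous: "\<And>c A. A \<in> carrier_mat n n \<Longrightarrow> \<Phi> (c \<cdot>\<^sub>m A) = c \<cdot>\<^sub>m \<Phi> A"
    and idem: "\<And>P. P \<in> carrier_mat n n \<Longrightarrow> idempotent_mat P \<Longrightarrow> idempotent_mat (\<Phi> P)"
  shows "(\<forall>A \<in> carrier_mat n n. \<forall>B \<in> carrier_mat n n.
            \<Phi> (A * B + B * A) = \<Phi> A * \<Phi> B + \<Phi> B * \<Phi> A)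
       \<and> (\<exists>S Sinv k1 k2. S \<in> carrier_mat r r \<and> Sinv \<in> carrier_mat r r
            \<and> S * Sinv = 1\<^sub>m r \<and> Sinv * S = 1\<^sub>m r
            \<and> n * k1 + n * k2 \<le> r
            \<and> (\<forall>A \<in> carrier_mat n n.
                 \<Phi> A = S * block_diag3 (kron_id k1 A) (kron_id k2 (transpose_mat A))
                                      (0\<^sub>m (r - n * k1 - n * k2) (r - n * k1 - n * k2)) * Sinv))"
proof -
  obtain M N where M: "matrix_units n r M" and N: "matrix_units n r N"
    and MN: "\<forall>i<n. \<forall>j<n. \<forall>k<n. \<forall>l<n. M i j * N k l = 0\<^sub>m r r"
    and NM: "\<forall>i<n. \<forall>j<n. \<forall>k<n. \<forall>l<n. N i j * M k l = 0\<^sub>m r r"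
    and \<Phi>_unit: "\<forall>i<n. \<forall>j<n. \<Phi> (unit_mat n i j) = M i j + N j i"
    by (rule matrix_unit_systems[OF char_not_2 maps_into additive idem])
  obtain k1 C R where C: "C \<in> carrier_mat r (k1 * n)" and R: "R \<in> carrier_mat (k1 * n) r"
    and RC: "R * C = 1\<^sub>m (k1 * n)"
    and CR: "\<forall>i<n. \<forall>j<n. C * kron_id k1 (unit_mat n i j) * R = M i j"
    and WC: "\<forall>m. \<forall>W \<in> carrier_mat m r. (\<forall>i<n. W * M i 0 = 0\<^sub>m m r) \<longrightarrow> W * C = 0\<^sub>m m (k1 * n)"
    and RV: "\<forall>m. \<forall>V \<in> carrier_mat r m. (\<forall>j<n. M 0 j * V = 0\<^sub>m r m) \<longrightarrow> R * V = 0\<^sub>m (k1 * n) m"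
    by (rule matrix_units_realization[OF M])
  obtain k2 C' R' where C': "C' \<in> carrier_mat r (k2 * n)" and R': "R' \<in> carrier_mat (k2 * n) r"
    and RC': "R' * C' = 1\<^sub>m (k2 * n)"
    and CR': "\<forall>i<n. \<forall>j<n. C' * kron_id k2 (unit_mat n i j) * R' = N i j"
    and WC': "\<forall>m. \<forall>W \<in> carrier_mat m r. (\<forall>i<n. W * N i 0 = 0\<^sub>m m r) \<longrightarrow> W * C' = 0\<^sub>m m (k2 * n)"
    and RV': "\<forall>m. \<forall>V \<in> carrier_mat r m. (\<forall>j<n. N 0 j * V = 0\<^sub>m r m) \<longrightarrow> R' * V = 0\<^sub>m (k2 * n) m"
    by (rule matrix_units_realization[OF N])
  have mem: "M 0 j \<in> carrier_mat r r" "N 0 j \<in> carrier_mat r r" if "j < n" for j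
    using M N that by (auto simp: matrix_units_def)
  \<comment> \<open>Annihilation is transferred in two stages: from \<open>M 0 j * N i 0 = 0\<close>
    to \<open>M 0 j * C' = 0\<close>, and from there to \<open>R * C' = 0\<close>; likewise with the
    systems exchanged.\<close>
  have "M 0 j * C' = 0\<^sub>m r (k2 * n)" "N 0 j * C = 0\<^sub>m r (k1 * n)" if "j < n" for j
    by (rule WC'[rule_format] WC[rule_format]; use mem MN NM that in auto)+
  then have mixed: "R * C' = 0\<^sub>m (k1 * n) (k2 * n)" "R' * C = 0\<^sub>m (k2 * n) (k1 * n)"
    by - (rule RV[rule_format, OF C'] RV'[rule_format, OF C]; simp)+

  let ?m = "k1 * n + k2 * n"
  define X where "X = hcat C C'"
  define Y where "Y = vcat R R'"
  have X: "X \<in> carrier_mat r ?m" and Y: "Y \<in> carrier_mat ?m r"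
    using C C' R R' by (simp_all add: X_def Y_def)
  have YX: "Y * X = 1\<^sub>m ?m"
    unfolding X_def Y_def using C C' R R' mixed
    by (subst vcat_mult_hcat[of _ r "k1 * n" _ "k2 * n" _ "k1 * n" _ "k2 * n"]) (simp_all add: RC RC')
  let ?D = "jordan_diag n k1 k2"
  have \<Phi>_eq: "\<Phi> A = X * ?D A * Y" if A: "A \<in> carrier_mat n n" for A
  proof (rule linear_eq_on_unit_mats[of n \<Phi> r], goal_cases)
    case (4 A)
    then show ?case using X Y by (meson jordan_diag_carrier mult_carrier_mat)
  next
    case (5 A B)
    then show ?case using X Y jordan_diag_carrier[of A n k1 k2] jordan_diag_carrier[of B n k1 k2]
      by (simp add: jordan_diag_add mult_add_distrib_mat[of X r ?m _ ?m] add_mult_distrib_mat[of _ r ?m _ Y r]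
        del: jordan_diag_carrier)
  next
    case (6 c A)
    then show ?case using X Y jordan_diag_carrier[of A n k1 k2]
      by (simp add: jordan_diag_smult mult_smult_distrib[of X r ?m _ ?m] mult_smult_assoc_mat[of _ r ?m Y r]
        del: jordan_diag_carrier)
  next
    \<comment> \<open>Transposing the unit in the second block turns \<open>N i j\<close> into
      \<open>N j i\<close>, as the splitting of \<open>\<Phi>\<close> demands.\<close>
    case (7 i j)
    have "X * ?D (unit_mat n i j) * Y
        = C * kron_id k1 (unit_mat n i j) * R + C' * kron_id k2 (unit_mat n j i) * R'"
      unfolding X_def Y_def jordan_diag_def transpose_unit_mat using C C' R R'
      by (intro hcat_diag_vcat) auto
    with 7 show ?case by (simp add: CR CR' \<Phi>_unit)
  qed (fact maps_into additive homogeneous A)+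
  \<comment> \<open>Because \<open>Y * X = 1\<close>, sandwiching between \<open>X\<close> and
    \<open>Y\<close> preserves products, so the Jordan property of \<open>jordan_diag\<close> passes
    to \<open>\<Phi>\<close>.\<close>
  have jordan: "\<Phi> (A * B + B * A) = \<Phi> A * \<Phi> B + \<Phi> B * \<Phi> A"
    if A: "A \<in> carrier_mat n n" and B: "B \<in> carrier_mat n n" for A B
  proof -
    have prod: "\<Phi> A * \<Phi> B = X * (?D A * ?D B) * Y"
      if "A \<in> carrier_mat n n" "B \<in> carrier_mat n n" for A B
    proof -
      note c = jordan_diag_carrier[OF that(1), of k1 k2] jordan_diag_carrier[OF that(2), of k1 k2]
      have "\<Phi> A * \<Phi> B = X * ?D A * (Y * X) * (?D B * Y)"
        using X Y c by (simp add: \<Phi>_eq that assoc_mult_mat[of _ r ?m _ ?m _ r]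
           assoc_mult_mat[of _ r ?m _ r _ r] assoc_mult_mat[of _ r ?m _ r _ ?m] assoc_mult_mat[of _ ?m ?m _ r _ r]
           assoc_mult_mat[of _ ?m r _ ?m _ r] assoc_mult_mat[of _ ?m ?m _ ?m _ r] del: jordan_diag_carrier)
      also have "\<dots> = X * (?D A * ?D B) * Y"
        using X Y c by (simp add: YX assoc_mult_mat[of _ r ?m _ ?m _ r] assoc_mult_mat[of _ r ?m _ ?m _ ?m]
           assoc_mult_mat[of _ ?m ?m _ ?m _ r] del: jordan_diag_carrier)
      finally show ?thesis .
    qed
    note c = jordan_diag_carrier[OF A, of k1 k2] jordan_diag_carrier[OF B, of k1 k2]
    have AB: "A * B + B * A \<in> carrier_mat n n" using A B by auto
    have "\<Phi> (A * B + B * A) = X * (?D A * ?D B + ?D B * ?D A) * Y"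
      by (simp add: \<Phi>_eq[OF AB] jordan_diag_jordan[OF A B])
    also have "\<dots> = X * (?D A * ?D B) * Y + X * (?D B * ?D A) * Y"
      by (simp only: mult_add_distrib_mat[OF X mult_carrier_mat[OF c] mult_carrier_mat[OF c(2,1)]]
        add_mult_distrib_mat[OF mult_carrier_mat[OF X mult_carrier_mat[OF c]]
          mult_carrier_mat[OF X mult_carrier_mat[OF c(2,1)]] Y])
    finally show ?thesis by (simp add: prod A B)
  qed
  \<comment> \<open>The idempotent complementary to \<open>X * Y\<close>; its factors
    \<open>C3\<close> and \<open>R3\<close> supply the basis vectors of the zero block.\<close>
  define Q where "Q = 1\<^sub>m r - X * Y"
  have XY: "X * Y \<in> carrier_mat r r" using X Y by auto
  then have Q: "Q \<in> carrier_mat r r" by (simp add: Q_def minus_carrier_mat)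
  have QX: "Q * X = 0\<^sub>m r ?m"
    using X by (simp add: Q_def minus_mult_distrib_mat[OF one_carrier_mat XY X] assoc_mult_mat[OF X Y X] YX)
  have YQ: "Y * Q = 0\<^sub>m ?m r"
    using Y by (simp add: Q_def mult_minus_distrib_mat[OF Y one_carrier_mat XY] YX
      flip: assoc_mult_mat[OF Y X Y])
  have "Q * Q = Q * 1\<^sub>m r - Q * (X * Y)"
    by (subst (2) Q_def) (rule mult_minus_distrib_mat[OF Q one_carrier_mat XY])
  also have "Q * (X * Y) = 0\<^sub>m r r"
    using Y by (simp add: QX flip: assoc_mult_mat[OF Q X Y])
  finally have "Q * Q = Q" using Q by auto
  with Q obtain t C3 R3 where C3: "C3 \<in> carrier_mat r t" and R3: "R3 \<in> carrier_mat t r"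
    and RC3: "R3 * C3 = 1\<^sub>m t" and CR3: "C3 * R3 = Q"
    by (rule idempotent_full_rank_factorization)
  have "Y * C3 = 0\<^sub>m ?m t" "R3 * X = 0\<^sub>m t ?m"
    using zero_if_right_inverse_factor[OF C3 R3 RC3 CR3] X Y YQ QX by blast+
  then have TS: "vcat Y R3 * hcat X C3 = 1\<^sub>m (?m + t)"
    using X Y C3 R3 by (subst vcat_mult_hcat[of _ r ?m _ t _ ?m _ t]) (simp_all add: YX RC3)
  have "hcat X C3 * vcat Y R3 = X * Y + Q"
    using X Y C3 R3 by (subst hcat_mult_vcat[of _ r ?m _ t _ r]) (simp_all add: CR3)
  also have "\<dots> = 1\<^sub>m r"
    using carrier_matD[OF XY] carrier_matD[OF Q] by (intro eq_matI) (simp_all add: Q_def del: index_mult_mat(1))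
  finally have ST: "hcat X C3 * vcat Y R3 = 1\<^sub>m r" .
  have S: "hcat X C3 \<in> carrier_mat r (?m + t)" and T: "vcat Y R3 \<in> carrier_mat (?m + t) r"
    using X Y C3 R3 by simp_all
  \<comment> \<open>Only now is the completed matrix known to be square, which yields both the bound
    on \<open>k1\<close> and \<open>k2\<close> and the size \<open>t\<close> of the zero
    block.\<close>
  have r: "r = ?m + t"
    by (rule invertible_imp_square[OF S T ST TS])
  then have t: "r - n * k1 - n * k2 = t" by (simp add: mult.commute)
  have "\<Phi> A = hcat X C3 * block_diag3 (kron_id k1 A) (kron_id k2 (transpose_mat A)) (0\<^sub>m t t) * vcat Y R3"
    if A: "A \<in> carrier_mat n n" for A
  proof -
    have "kron_id k1 A \<in> carrier_mat (k1 * n) (k1 * n)"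
      "kron_id k2 (transpose_mat A) \<in> carrier_mat (k2 * n) (k2 * n)" using A by simp_all
    then have "block_diag3 (kron_id k1 A) (kron_id k2 (transpose_mat A)) (0\<^sub>m t t)
        = four_block_mat (?D A) (0\<^sub>m ?m t) (0\<^sub>m t ?m) (0\<^sub>m t t)"
      by (simp add: block_diag3_def jordan_diag_def)
    then have "hcat X C3 * block_diag3 (kron_id k1 A) (kron_id k2 (transpose_mat A)) (0\<^sub>m t t) * vcat Y R3
        = X * ?D A * Y + C3 * 0\<^sub>m t t * R3"
      using hcat_diag_vcat[of X r ?m C3 t "?D A" "0\<^sub>m t t" Y r R3] X Y C3 R3 A by simp
    also have "\<dots> = \<Phi> A"
      using C3 R3 maps_into[OF A] by (simp add: \<Phi>_eq[OF A])
    finally show ?thesis ..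
  qed
  then have "\<exists>S Sinv k1 k2. S \<in> carrier_mat r r \<and> Sinv \<in> carrier_mat r r
            \<and> S * Sinv = 1\<^sub>m r \<and> Sinv * S = 1\<^sub>m r
            \<and> n * k1 + n * k2 \<le> r
            \<and> (\<forall>A \<in> carrier_mat n n.
                 \<Phi> A = S * block_diag3 (kron_id k1 A) (kron_id k2 (transpose_mat A))
                                      (0\<^sub>m (r - n * k1 - n * k2) (r - n * k1 - n * k2)) * Sinv)"
    using S T ST TS
    by (intro exI[of _ "hcat X C3"] exI[of _ "vcat Y R3"] exI[of _ k1] exI[of _ k2])
      (simp add: t flip: r, simp add: r mult.commute)
  with jordan show ?thesis by blast
qed

end
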